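(* For any nonempty $\Pi^0_1$ sets $P,Q\subseteq2^{\mathbb N}$, $Q^\frown P$ does not $(1,1)$-cup to $P$; that is to say, for any $R\subseteq\mathbb N^{\mathbb N}$, if $P\le^1_1(Q^\frown P)\otimes R$ then $P\le^1_1R$.
   Context: For $A,B\subseteq\mathbb N^{\mathbb N}$, $A\le^1_1B$ (Medvedev reducibility) means that there is a partial computable function $\Gamma:\subseteq\mathbb N^{\mathbb N}\to\mathbb N^{\mathbb N}$ defined on all of $B$ with $\Gamma(g)\in A$ for every $g\in B$. For $f,g\in\mathbb N^{\mathbb N}$, $(f\oplus g)(2n)=f(n)$ and $(f\oplus g)(2n+1)=g(n)$; and $A\otimes B=\{f\oplus g:f\in A,\ g\in B\}$. With each $\Pi^0_1$ set $Q\subseteq2^{\mathbb N}$ (given by an index) a corresponding computable tree $T_Q\subseteq2^{<\mathbb N}$ whose set of infinite paths is $Q$ is fixed; $L_Q$ is the set of leaves (dead ends) of $T_Q$, i.e. strings in $T_Q$ with no proper extension in $T_Q$. The concatenation of $Q$ and $P$ is $Q^\frown P=Q\cup\bigcup_{\rho\in L_Q}\rho^\frown P$, where $\rho^\frown P=\{\rho^\frown f:f\in P\}$. *)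

theory Defs
  imports Complex_Main "HOL-Library.Nat_Bijection" "HOL-Library.Sublist" "HOL-Library.Omega_Words_Fun"
begin

section \<open>Computability with an oracle\<close>

text \<open>
  Kleene's scheme of partial recursive functions, with the oracle \<open>g\<close> as one extra
  initial function; \<open>eval g e xs y\<close> says that \<open>e\<close> run with oracle \<open>g\<close> on the
  arguments \<open>xs\<close> halts with value \<open>y\<close>. Arities are not tracked in the syntax:
  accessing a missing argument diverges, and superfluous arguments are ignored.
\<close>

datatype prog =
    Zero
  | Succ
  | Proj nat
  | Oracle
  | Comp prog "prog list"
  | PrimRec prog prog
  | Mu prog

inductive eval :: "(nat \<Rightarrow> nat) \<Rightarrow> prog \<Rightarrow> nat list \<Rightarrow> nat \<Rightarrow> bool"
  for g :: "nat \<Rightarrow> nat"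
  where
  eval_Zero: "eval g Zero xs 0"
| eval_Succ: "eval g Succ (x # xs) (Suc x)"
| eval_Proj: "i < length xs \<Longrightarrow> eval g (Proj i) xs (xs ! i)"
| eval_Oracle: "eval g Oracle (x # xs) (g x)"
| eval_Comp: "list_all2 (\<lambda>f y. eval g f xs y) fs ys \<Longrightarrow> eval g h ys z
    \<Longrightarrow> eval g (Comp h fs) xs z"
| eval_PrimRec_0: "eval g f xs y \<Longrightarrow> eval g (PrimRec f h) (0 # xs) y"
| eval_PrimRec_Suc: "eval g (PrimRec f h) (n # xs) r \<Longrightarrow> eval g h (n # r # xs) y
    \<Longrightarrow> eval g (PrimRec f h) (Suc n # xs) y"
| eval_Mu: "eval g f (n # xs) 0 \<Longrightarrow> (\<forall>i<n. \<exists>r. eval g f (i # xs) (Suc r))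
    \<Longrightarrow> eval g (Mu f) xs n"

lemma eval_deterministic:
  assumes "eval g e xs y" "eval g e xs z"
  shows "y = z"
  using assms
proof (induction arbitrary: z rule: eval.induct)
  case (eval_Comp xs fs ys h w)
  from eval_Comp.prems obtain ys' where
    ys': "list_all2 (\<lambda>f y. eval g f xs y) fs ys'" "eval g h ys' z"
    by (auto elim: eval.cases)
  have "ys = ys'"
    using eval_Comp.IH(1) ys'(1) by (auto simp: list_all2_conv_all_nth intro: nth_equalityI)
  then show ?case using eval_Comp.IH(2) ys'(2) by blast
next
  case (eval_PrimRec_0 f xs y h)
  from eval_PrimRec_0.prems show ?case
    by (cases rule: eval.cases) (auto dest: eval_PrimRec_0.IH)
next
  case (eval_PrimRec_Suc f h n xs r y)
  from eval_PrimRec_Suc.prems show ?case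
    by (cases rule: eval.cases) (use eval_PrimRec_Suc.IH in blast)+
next
  case (eval_Mu f n xs)
  from eval_Mu.prems have z: "eval g f (z # xs) 0" "\<forall>i<z. \<exists>r. eval g f (i # xs) (Suc r)"
    by (auto elim: eval.cases)
  show ?case
  proof (rule linorder_cases[of n z])
    assume "n < z"
    then obtain r where "eval g f (n # xs) (Suc r)" using z(2) by blast
    then show ?thesis using eval_Mu.IH(1) by blast
  next
    assume "z < n"
    then show ?thesis using eval_Mu.IH(2) z(1) by blast
  qed
qed (auto elim: eval.cases)

fun oracle_free :: "prog \<Rightarrow> bool" where
  "oracle_free Oracle = False"
| "oracle_free (Comp h fs) = (oracle_free h \<and> (\<forall>f\<in>set fs. oracle_free f))"
| "oracle_free (PrimRec f h) = (oracle_free f \<and> oracle_free h)"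
| "oracle_free (Mu f) = oracle_free f"
| "oracle_free _ = True"

text \<open>The oracle \<open>g\<close> below is irrelevant, as the program does not query it.\<close>

definition computable_set :: "nat set \<Rightarrow> bool" where
  "computable_set S \<longleftrightarrow>
    (\<exists>e. oracle_free e \<and> (\<forall>g n. eval g e [n] (if n \<in> S then 1 else 0)))"

definition computable_rel :: "((nat \<Rightarrow> nat) \<Rightarrow> nat \<Rightarrow> bool) \<Rightarrow> bool" where
  "computable_rel R \<longleftrightarrow> (\<exists>e. \<forall>f n. eval f e [n] (if R f n then 1 else 0))"

text \<open>A partial computable functional is defined exactly where its program is total.\<close>

definition partial_computable :: "((nat \<Rightarrow> nat) \<rightharpoonup> (nat \<Rightarrow> nat)) \<Rightarrow> bool" where
  "partial_computable \<Gamma> \<longleftrightarrow> (\<exists>e. \<forall>g f. \<Gamma> g = Some f \<longleftrightarrow> (\<forall>n. eval g e [n] (f n)))"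

lemma prog_partial_computable:
  "\<exists>\<Gamma>. partial_computable \<Gamma> \<and> (\<forall>g f. \<Gamma> g = Some f \<longleftrightarrow> (\<forall>n. eval g e [n] (f n)))"
proof -
  define \<Gamma> where "\<Gamma> g = (if \<exists>f. \<forall>n. eval g e [n] (f n)
    then Some (SOME f. \<forall>n. eval g e [n] (f n)) else None)" for g
  have "\<Gamma> g = Some f \<longleftrightarrow> (\<forall>n. eval g e [n] (f n))" for g f
  proof
    assume f: "\<Gamma> g = Some f"
    then have ex: "\<exists>f. \<forall>n. eval g e [n] (f n)"
      by (auto simp: \<Gamma>_def split: if_splits)
    with f have "f = (SOME f. \<forall>n. eval g e [n] (f n))" by (simp add: \<Gamma>_def)
    with someI_ex[OF ex] show "\<forall>n. eval g e [n] (f n)" by simp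
  next
    assume f: "\<forall>n. eval g e [n] (f n)"
    then have "\<forall>n. eval g e [n] ((SOME f. \<forall>n. eval g e [n] (f n)) n)"
      by (rule someI[where P = "\<lambda>f. \<forall>n. eval g e [n] (f n)"])
    with f have "(SOME f. \<forall>n. eval g e [n] (f n)) = f"
      by (blast intro: eval_deterministic)
    with f show "\<Gamma> g = Some f" unfolding \<Gamma>_def by auto
  qed
  then show ?thesis unfolding partial_computable_def by blast
qed


section \<open>Medvedev reducibility\<close>

definition medvedev_le :: "(nat \<Rightarrow> nat) set \<Rightarrow> (nat \<Rightarrow> nat) set \<Rightarrow> bool"  (infix \<open>\<le>\<^sub>M\<close> 50) where
  "A \<le>\<^sub>M B \<longleftrightarrow>
    (\<exists>\<Gamma>. partial_computable \<Gamma> \<and> B \<subseteq> dom \<Gamma> \<and> (\<forall>g\<in>B. the (\<Gamma> g) \<in> A))"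

definition join :: "(nat \<Rightarrow> nat) \<Rightarrow> (nat \<Rightarrow> nat) \<Rightarrow> nat \<Rightarrow> nat"  (infixr \<open>\<oplus>\<close> 65) where
  "(f \<oplus> g) n = (if even n then f (n div 2) else g (n div 2))"

definition product :: "(nat \<Rightarrow> nat) set \<Rightarrow> (nat \<Rightarrow> nat) set \<Rightarrow> (nat \<Rightarrow> nat) set"
  (infixr \<open>\<otimes>\<close> 70) where
  "A \<otimes> B = {f \<oplus> g | f g. f \<in> A \<and> g \<in> B}"


section \<open>Effectively closed sets, trees and concatenation\<close>

definition cantor :: "(nat \<Rightarrow> nat) set" where
  "cantor = {f. \<forall>n. f n \<in> {0, 1}}"

definition pi01 :: "(nat \<Rightarrow> nat) set \<Rightarrow> bool" where
  "pi01 P \<longleftrightarrow> (\<exists>R. computable_rel R \<and> P = {f. \<forall>n. R f n})"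

text \<open>
  The bare name \<open>prefix\<close> refers to initial segments of infinite words here, whence the
  qualified \<open>Sublist.prefix\<close> for lists.
\<close>

definition computable_binary_tree :: "nat list set \<Rightarrow> bool" where
  "computable_binary_tree T \<longleftrightarrow>
    T \<subseteq> lists {0, 1} \<and>
    (\<forall>\<sigma>\<in>T. \<forall>\<tau>. Sublist.prefix \<tau> \<sigma> \<longrightarrow> \<tau> \<in> T) \<and>
    computable_set (list_encode ` T)"

definition paths :: "nat list set \<Rightarrow> (nat \<Rightarrow> nat) set" where
  "paths T = {f. \<forall>n. map f [0..<n] \<in> T}"

definition leaves :: "nat list set \<Rightarrow> nat list set" where
  "leaves T = {\<sigma> \<in> T. \<not> (\<exists>\<tau>\<in>T. strict_prefix \<sigma> \<tau>)}"

text \<open>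
  The concatenation depends on the tree chosen to represent its first component, not only on
  that component; so the tree \<open>T\<close> is the argument, and \<open>paths T\<close> is the first component.
\<close>

definition concatenation :: "nat list set \<Rightarrow> (nat \<Rightarrow> nat) set \<Rightarrow> (nat \<Rightarrow> nat) set" where
  "concatenation T P = paths T \<union> (\<Union>\<rho>\<in>leaves T. {\<rho> \<frown> f | f. f \<in> P})"

end

theory Submission
  imports Defs
begin

text \<open>
  Let \<open>\<Gamma>\<close> reduce \<open>P\<close> to the product and fix \<open>g \<in> R\<close>; write \<open>\<Phi> f\<close> for \<open>\<Gamma> (f \<oplus> g)\<close>.
  If the lengths of the leaves of the tree are bounded, then the tree has a computable path \<open>q\<close>, and
  \<open>\<Phi> q \<in> P\<close> is uniformly computable from \<open>g\<close>.

  Otherwise nest the functional: for leaves \<open>\<rho>\<^sub>0, \<dots>, \<rho>\<^sub>n\<close> and any \<open>f \<in> P\<close> the function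
  \<open>\<Phi> (\<rho>\<^sub>0 \<frown> \<Phi> (\<rho>\<^sub>1 \<frown> \<dots> \<Phi> (\<rho>\<^sub>n \<frown> f)))\<close> is in \<open>P\<close>, so its initial segments that are already
  determined without \<open>f\<close> extend to members of \<open>P\<close> and cohere as \<open>n\<close> grows. Given
  \<open>\<rho>\<^sub>0, \<dots>, \<rho>\<^sub>n\<^sub>-\<^sub>1\<close>, compactness of \<open>P\<close> yields an \<open>N\<close> such that \<open>N\<close> values of the innermost argument
  determine \<open>n + 1\<close> values of the result, and compactness of the paths of the tree yields a leaf
  \<open>\<rho>\<^sub>n\<close> which alone determines \<open>N\<close> values of \<open>\<Phi> (\<rho>\<^sub>n \<frown> f)\<close>. So a search for \<open>\<rho>\<^sub>n\<close> succeeds, and the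
  limit, which is in \<open>P\<close> as \<open>P\<close> is closed, is computable from \<open>g\<close>.
\<close>

section \<open>Closure properties of computable functions\<close>

text \<open>Only oracles in \<open>R\<close> have to be handled correctly: the unbounded searches below terminate for
  these only.\<close>

definition computes :: "(nat \<Rightarrow> nat) set \<Rightarrow> nat \<Rightarrow> ((nat \<Rightarrow> nat) \<Rightarrow> nat list \<Rightarrow> nat) \<Rightarrow> bool" where
  "computes R k F \<longleftrightarrow> (\<exists>e. \<forall>g\<in>R. \<forall>xs. length xs = k \<longrightarrow> eval g e xs (F g xs))"

definition decides :: "(nat \<Rightarrow> nat) set \<Rightarrow> nat \<Rightarrow> ((nat \<Rightarrow> nat) \<Rightarrow> nat list \<Rightarrow> bool) \<Rightarrow> bool" where
  "decides R k P \<longleftrightarrow> computes R k (\<lambda>g xs. if P g xs then 1 else 0)"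

lemma computes_cong:
  assumes "computes R k F" "\<And>g xs. length xs = k \<Longrightarrow> F g xs = G g xs"
  shows "computes R k G"
  using assms unfolding computes_def by metis

lemma decides_cong:
  assumes "decides R k P" "\<And>g xs. length xs = k \<Longrightarrow> P g xs = Q g xs"
  shows "decides R k Q"
  using assms(1) unfolding decides_def by (rule computes_cong) (simp add: assms(2))

lemma computes_call:
  assumes "computes R (length Fs) G" "\<And>F. F \<in> set Fs \<Longrightarrow> computes R k F"
  shows "computes R k (\<lambda>g xs. G g (map (\<lambda>F. F g xs) Fs))"
proof -
  obtain e where e: "\<And>g xs. g \<in> R \<Longrightarrow> length xs = length Fs \<Longrightarrow> eval g e xs (G g xs)"
    using assms(1) unfolding computes_def by blast
  obtain p where p: "\<And>F g xs. F \<in> set Fs \<Longrightarrow> g \<in> R \<Longrightarrow> length xs = k \<Longrightarrow> eval g (p F) xs (F g xs)"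
    using assms(2) unfolding computes_def by metis
  have "eval g (Comp e (map p Fs)) xs (G g (map (\<lambda>F. F g xs) Fs))" if "g \<in> R" "length xs = k" for g xs
    by (rule eval_Comp[where ys = "map (\<lambda>F. F g xs) Fs"])
      (auto simp: list_all2_conv_all_nth p that intro!: e)
  then show ?thesis unfolding computes_def by blast
qed

lemma computes_call1:
  assumes "computes R 1 (\<lambda>g xs. f g (xs ! 0))" "computes R k A"
  shows "computes R k (\<lambda>g xs. f g (A g xs))"
  using computes_call[of R "[A]" "\<lambda>g xs. f g (xs ! 0)" k] assms by simp

lemma computes_call2:
  assumes "computes R 2 (\<lambda>g xs. f g (xs ! 0) (xs ! 1))" "computes R k A" "computes R k B"
  shows "computes R k (\<lambda>g xs. f g (A g xs) (B g xs))"
  using computes_call[of R "[A, B]" "\<lambda>g xs. f g (xs ! 0) (xs ! 1)" k] assms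
  by (auto simp: numeral_eq_Suc)

lemma computes_call3:
  assumes "computes R 3 (\<lambda>g xs. f g (xs ! 0) (xs ! 1) (xs ! 2))"
    "computes R k A" "computes R k B" "computes R k C"
  shows "computes R k (\<lambda>g xs. f g (A g xs) (B g xs) (C g xs))"
  using computes_call[of R "[A, B, C]" "\<lambda>g xs. f g (xs ! 0) (xs ! 1) (xs ! 2)" k] assms
  by (auto simp: numeral_eq_Suc)

lemma computes_nth: "i < k \<Longrightarrow> computes R k (\<lambda>g xs. xs ! i)"
  unfolding computes_def by (rule exI[of _ "Proj i"]) (auto intro: eval_Proj)

lemma computes_Suc:
  assumes "computes R k A" shows "computes R k (\<lambda>g xs. Suc (A g xs))"
proof (rule computes_call1[OF _ assms])
  show "computes R 1 (\<lambda>g xs. Suc (xs ! 0))"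
    unfolding computes_def
    by (rule exI[of _ Succ]) (auto simp: length_Suc_conv intro: eval_Succ)
qed

lemma computes_const: "computes R k (\<lambda>g xs. n)"
proof (induction n)
  case 0
  then show ?case unfolding computes_def by (meson eval_Zero)
qed (rule computes_Suc)

lemma computes_oracle:
  assumes "computes R k A" shows "computes R k (\<lambda>g xs. g (A g xs))"
proof (rule computes_call1[OF _ assms, where f = "\<lambda>g x. g x"])
  show "computes R 1 (\<lambda>g xs. g (xs ! 0))"
    unfolding computes_def
    by (rule exI[of _ Oracle]) (auto simp: length_Suc_conv intro: eval_Oracle)
qed

text \<open>Recursion puts its auxiliary values in front of the argument list; this substitutes for
  that front part and keeps the last \<open>m\<close> arguments.\<close>

lemma computes_call_append:
  assumes "computes R (length Fs + m) G" "\<And>F. F \<in> set Fs \<Longrightarrow> computes R (n + m) F"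
  shows "computes R (n + m) (\<lambda>g ys. G g (map (\<lambda>F. F g ys) Fs @ drop n ys))"
proof -
  let ?Fs = "Fs @ map (\<lambda>i g ys. ys ! (n + i)) [0..<m]"
  have "computes R (n + m) (\<lambda>g ys. G g (map (\<lambda>F. F g ys) ?Fs))"
  proof (rule computes_call)
    show "computes R (length ?Fs) G" using assms(1) by simp
    show "computes R (n + m) F" if "F \<in> set ?Fs" for F
      using that assms(2) by (auto intro: computes_nth)
  qed
  then show ?thesis
    by (rule computes_cong) (auto intro!: arg_cong[of _ _ "G _"] nth_equalityI)
qed

lemma computes_drop:
  assumes "computes R k F" shows "computes R (Suc (Suc k)) (\<lambda>g ys. F g (drop 2 ys))"
  using computes_call_append[of R "[]" k F 2] assms by simp

text \<open>\<open>PrimRec\<close> recurses on the head of the argument list, so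
  \<open>N g xs\<close> is put in front by \<open>computes_call_append\<close>. Counter and previous
  value are the two arguments that \<open>drop 2\<close> removes.\<close>

lemma computes_rec:
  assumes "computes R k N" "computes R k A"
    and "computes R (Suc (Suc k)) (\<lambda>g ys. B g (ys ! 0) (ys ! 1) (drop 2 ys))"
  shows "computes R k (\<lambda>g xs. rec_nat (A g xs) (\<lambda>n r. B g n r xs) (N g xs))"
proof -
  obtain a b where a: "\<And>g xs. g \<in> R \<Longrightarrow> length xs = k \<Longrightarrow> eval g a xs (A g xs)"
    and b: "\<And>g ys. g \<in> R \<Longrightarrow> length ys = Suc (Suc k)
      \<Longrightarrow> eval g b ys (B g (ys ! 0) (ys ! 1) (drop 2 ys))"
    using assms(2,3) unfolding computes_def by blast
  have rec: "eval g (PrimRec a b) (n # xs) (rec_nat (A g xs) (\<lambda>n r. B g n r xs) n)"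
    if "g \<in> R" "length xs = k" for g n xs
  proof (induction n)
    case 0
    then show ?case by (simp add: a eval_PrimRec_0 that)
  next
    case (Suc n)
    have "eval g b (n # r # xs) (B g n r xs)" for r
      using b[of g "n # r # xs"] that by (simp add: numeral_eq_Suc)
    then show ?case using eval_PrimRec_Suc[OF Suc] by simp
  qed
  have "computes R (Suc k)
      (\<lambda>g ys. rec_nat (A g (tl ys)) (\<lambda>n r. B g n r (tl ys)) (hd ys))"
    unfolding computes_def
    by (rule exI[of _ "PrimRec a b"]) (auto simp: length_Suc_conv rec)
  from computes_call_append[of R "[N]" k _ 0, simplified, OF this assms(1)]
  show ?thesis by simp
qed

lemma computes_Least:
  assumes "decides R (Suc k) (\<lambda>g ys. P g (ys ! 0) (tl ys))"
    and "\<And>g xs. g \<in> R \<Longrightarrow> length xs = k \<Longrightarrow> \<exists>n. P g n xs"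
  shows "computes R k (\<lambda>g xs. LEAST n. P g n xs)"
proof -
  \<comment> \<open>\<open>Mu\<close> looks for a zero whereas truth is coded by 1; this recursion
    sends 0 to 1 and every successor to 0.\<close>
  have "computes R 1 (\<lambda>g xs. rec_nat 1 (\<lambda>_ _. 0) (xs ! 0))"
    by (rule computes_rec) (auto intro: computes_nth computes_const)
  from computes_call1[OF this assms(1)[unfolded decides_def]]
  obtain e where e: "\<And>g ys. g \<in> R \<Longrightarrow> length ys = Suc k \<Longrightarrow>
      eval g e ys (rec_nat 1 (\<lambda>_ _. 0) (if P g (ys ! 0) (tl ys) then 1 else 0))"
    unfolding computes_def by blast
  have e0: "eval g e (n # xs) 0" if "g \<in> R" "length xs = k" "P g n xs" for g n xs
    using e[of g "n # xs"] that by simp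
  have e1: "eval g e (n # xs) (Suc 0)" if "g \<in> R" "length xs = k" "\<not> P g n xs" for g n xs
    using e[of g "n # xs"] that by simp
  have "eval g (Mu e) xs (LEAST n. P g n xs)" if k: "g \<in> R" "length xs = k" for g xs
  proof (rule eval_Mu)
    show "eval g e ((LEAST n. P g n xs) # xs) 0"
      by (rule e0[OF k LeastI_ex[OF assms(2)[OF k]]])
    show "\<forall>i<LEAST n. P g n xs. \<exists>r. eval g e (i # xs) (Suc r)"
    proof (intro allI impI)
      fix i assume "i < (LEAST n. P g n xs)"
      then have "\<not> P g i xs" by (rule not_less_Least)
      from e1[OF k this] show "\<exists>r. eval g e (i # xs) (Suc r)" ..
    qed
  qed
  then show ?thesis unfolding computes_def by blast
qed

lemma computes_add:
  assumes "computes R k A" "computes R k B" shows "computes R k (\<lambda>g xs. A g xs + B g xs)"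
proof (rule computes_call2[OF _ assms])
  have "computes R 2 (\<lambda>g xs. rec_nat (xs ! 0) (\<lambda>_ r. Suc r) (xs ! 1))"
    by (intro computes_rec computes_nth computes_Suc) auto
  moreover have "rec_nat a (\<lambda>_ r. Suc r) b = a + b" for a b
    by (induction b) auto
  ultimately show "computes R 2 (\<lambda>g xs. xs ! 0 + xs ! 1)" by simp
qed

lemma computes_diff:
  assumes "computes R k A" "computes R k B" shows "computes R k (\<lambda>g xs. A g xs - B g xs)"
proof -
  have "computes R 1 (\<lambda>g xs. rec_nat 0 (\<lambda>n _. n) (xs ! 0))"
    by (intro computes_rec computes_nth computes_const) auto
  moreover have "rec_nat 0 (\<lambda>n _. n) a = a - 1" for a :: nat
    by (cases a) auto
  ultimately have pred: "computes R 1 (\<lambda>g xs. xs ! 0 - 1)" by simp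
  have "computes R 2 (\<lambda>g xs. rec_nat (xs ! 0) (\<lambda>_ r. r - 1) (xs ! 1))"
    by (intro computes_rec computes_nth computes_call1[OF pred]) auto
  moreover have "rec_nat a (\<lambda>_ r. r - 1) b = a - b" for a b :: nat
    by (induction b) auto
  ultimately have "computes R 2 (\<lambda>g xs. xs ! 0 - xs ! 1)" by simp
  then show ?thesis by (rule computes_call2[OF _ assms])
qed

lemma computes_if:
  assumes "decides R k P" "computes R k A" "computes R k B"
  shows "computes R k (\<lambda>g xs. if P g xs then A g xs else B g xs)"
proof -
  have "computes R k (\<lambda>g xs. rec_nat (B g xs) (\<lambda>_ _. A g xs) (if P g xs then 1 else 0))"
    using assms unfolding decides_def by (intro computes_rec computes_drop)
  then show ?thesis by (rule computes_cong) simp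
qed

lemma decides_le:
  assumes "computes R k A" "computes R k B" shows "decides R k (\<lambda>g xs. A g xs \<le> B g xs)"
proof -
  have "computes R k (\<lambda>g xs. 1 - (A g xs - B g xs))"
    by (intro computes_diff computes_const assms)
  then show ?thesis unfolding decides_def by (rule computes_cong) auto
qed

lemma decides_not:
  assumes "decides R k P" shows "decides R k (\<lambda>g xs. \<not> P g xs)"
  unfolding decides_def
  by (rule computes_cong[OF computes_if[OF assms computes_const[of R k 0] computes_const[of R k 1]]]) simp

lemma decides_conj:
  assumes "decides R k P" "decides R k Q" shows "decides R k (\<lambda>g xs. P g xs \<and> Q g xs)"
  unfolding decides_def
  by (rule computes_cong[OF computes_if[OF assms(1) assms(2)[unfolded decides_def] computes_const[of R k 0]]]) simp

lemma decides_less: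
  assumes "computes R k A" "computes R k B" shows "decides R k (\<lambda>g xs. A g xs < B g xs)"
  using decides_not[OF decides_le[OF assms(2,1)]] by (simp add: not_le)

lemma decides_eq:
  assumes "computes R k A" "computes R k B" shows "decides R k (\<lambda>g xs. A g xs = B g xs)"
  using decides_conj[OF decides_le[OF assms] decides_le[OF assms(2,1)]]
  by (simp add: order_eq_iff)

lemma decides_all:
  assumes "computes R k N" "decides R (Suc k) (\<lambda>g ys. P g (ys ! 0) (tl ys))"
  shows "decides R k (\<lambda>g xs. \<forall>i<N g xs. P g i xs)"
proof -
  define q where "q g ys = (if P g (ys ! 0) (tl ys) then 1 else 0 :: nat)" for g ys
  have "computes R (Suc k) q"
    using assms(2) unfolding decides_def q_def .
  \<comment> \<open>The step of the recursion sees counter, accumulator and \<open>xs\<close>; here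
    the accumulator is skipped.\<close>
  then have q: "computes R (Suc (Suc k)) (\<lambda>g ys. q g (ys ! 0 # drop 2 ys))"
    using computes_call_append[of R "[\<lambda>g ys. ys ! 0]" k q 2] by (simp add: computes_nth)
  have "computes R k (\<lambda>g xs. rec_nat 1 (\<lambda>n r. if r = 0 then 0 else q g (n # xs)) (N g xs))"
    by (rule computes_rec) (auto intro!: assms(1) computes_const computes_if decides_eq computes_nth q)
  moreover have "rec_nat 1 (\<lambda>n r. if r = 0 then 0 else q g (n # xs)) m
      = (if \<forall>i<m. P g i xs then 1 else 0)" for g xs m
    by (induction m) (auto simp: q_def less_Suc_eq)
  ultimately show ?thesis unfolding decides_def by simp
qed

lemma computes_nth_tl:
  assumes "Suc i < k" shows "computes R k (\<lambda>g xs. tl xs ! i)"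
  using computes_nth[OF assms] by (rule computes_cong) (use assms in \<open>simp add: nth_tl\<close>)

lemmas computes_intros = computes_Suc computes_const computes_oracle computes_add computes_diff computes_if
  decides_le decides_not decides_conj decides_less decides_eq computes_nth computes_nth_tl

section \<open>Coding of pairs and lists\<close>

lemma computes_triangle:
  assumes "computes R k A" shows "computes R k (\<lambda>g xs. triangle (A g xs))"
proof (rule computes_call1[OF _ assms])
  have "computes R 1 (\<lambda>g xs. rec_nat 0 (\<lambda>n r. r + Suc n) (xs ! 0))"
    by (intro computes_rec computes_intros) auto
  moreover have "rec_nat 0 (\<lambda>n r. r + Suc n) a = triangle a" for a
    by (induction a) auto
  ultimately show "computes R 1 (\<lambda>g xs. triangle (xs ! 0))" by simp
qed

lemma computes_prod_encode:
  assumes "computes R k A" "computes R k B"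
  shows "computes R k (\<lambda>g xs. prod_encode (A g xs, B g xs))"
  unfolding prod_encode_def by (simp add: assms computes_add computes_triangle)

lemma strict_mono_triangle: "strict_mono triangle"
  by (simp add: strict_mono_Suc_iff)

text \<open>\<open>prod_encode (a, b)\<close> is \<open>triangle (a + b) + a\<close>, so this search
  recovers the diagonal \<open>a + b\<close>, and from it both components.\<close>

lemma Least_triangle:
  "(LEAST j. prod_encode (a, b) < triangle (Suc j)) = a + b"
proof (rule Least_equality)
  show "prod_encode (a, b) < triangle (Suc (a + b))" by (simp add: prod_encode_def)
  show "a + b \<le> j" if "prod_encode (a, b) < triangle (Suc j)" for j
  proof -
    have "triangle (a + b) < triangle (Suc j)" using that by (simp add: prod_encode_def)
    then have "a + b < Suc j" by (simp only: strict_mono_less[OF strict_mono_triangle])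
    then show ?thesis by simp
  qed
qed

lemma computes_prod_decode:
  assumes "computes R k A"
  shows "computes R k (\<lambda>g xs. fst (prod_decode (A g xs)))"
    "computes R k (\<lambda>g xs. snd (prod_decode (A g xs)))"
proof -
  have ex: "\<exists>j. z < triangle (Suc j)" for z
    by (rule exI[of _ z]) simp
  have L: "computes R 1 (\<lambda>g xs. LEAST j. xs ! 0 < triangle (Suc j))"
    by (rule computes_Least[OF _ ex]) (intro computes_intros computes_triangle; simp)
  have "computes R 1 (\<lambda>g xs. xs ! 0 - triangle (LEAST j. xs ! 0 < triangle (Suc j)))"
    by (intro computes_intros computes_triangle L) auto
  moreover have "z - triangle (LEAST j. z < triangle (Suc j)) = fst (prod_decode z)" for z
  proof -
    obtain a b where "prod_decode z = (a, b)" by fastforce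
    then have "z = prod_encode (a, b)" by (metis prod_decode_inverse)
    then show ?thesis by (simp only: Least_triangle prod_encode_inverse) (simp add: prod_encode_def)
  qed
  ultimately have 1: "computes R 1 (\<lambda>g xs. fst (prod_decode (xs ! 0)))" by simp
  show "computes R k (\<lambda>g xs. fst (prod_decode (A g xs)))" by (rule computes_call1[OF 1 assms])
  have "computes R 1 (\<lambda>g xs. (LEAST j. xs ! 0 < triangle (Suc j)) - fst (prod_decode (xs ! 0)))"
    by (intro computes_intros 1 L)
  moreover have "(LEAST j. z < triangle (Suc j)) - fst (prod_decode z) = snd (prod_decode z)" for z
  proof -
    obtain a b where "prod_decode z = (a, b)" by fastforce
    then have "z = prod_encode (a, b)" by (metis prod_decode_inverse)
    then show ?thesis by (simp only: Least_triangle prod_encode_inverse) simp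
  qed
  ultimately have 2: "computes R 1 (\<lambda>g xs. snd (prod_decode (xs ! 0)))" by simp
  show "computes R k (\<lambda>g xs. snd (prod_decode (A g xs)))" by (rule computes_call1[OF 2 assms])
qed

lemma computes_div2:
  assumes "computes R k A" shows "computes R k (\<lambda>g xs. A g xs div 2)"
proof (rule computes_call1[OF _ assms])
  have "computes R 1 (\<lambda>g xs. LEAST j. xs ! 0 < Suc (Suc (j + j)))"
  proof (rule computes_Least)
    show "\<exists>j. xs ! 0 < Suc (Suc (j + j))" for xs :: "nat list"
      by (rule exI[of _ "xs ! 0"]) simp
  qed (intro computes_intros; simp)
  moreover have "(LEAST j. z < Suc (Suc (j + j))) = z div 2" for z :: nat
    by (rule Least_equality) auto
  ultimately show "computes R 1 (\<lambda>g xs. xs ! 0 div 2)" by simp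
qed

lemma decides_even:
  assumes "computes R k A" shows "decides R k (\<lambda>g xs. even (A g xs))"
proof -
  have "decides R k (\<lambda>g xs. A g xs div 2 + A g xs div 2 = A g xs)"
    by (rule decides_eq[OF computes_add[OF computes_div2[OF assms] computes_div2[OF assms]] assms])
  moreover have "n div 2 + n div 2 = n \<longleftrightarrow> even n" for n :: nat by presburger
  ultimately show ?thesis by simp
qed

text \<open>The convention for partial values used by \<open>stage\<close>: 0 marks an index out of
  range, a successor marks an entry.\<close>

definition look :: "nat list \<Rightarrow> nat \<Rightarrow> nat" where
  "look xs i = (if i < length xs then Suc (xs ! i) else 0)"

text \<open>The code of a nonempty list is the successor of the pair of its head and the code of its
  tail, so dropping \<open>i\<close> entries is an \<open>i\<close>-fold iteration of
  \<open>snd (prod_decode (r - 1))\<close>.\<close>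

lemma computes_look:
  assumes "computes R k A" "computes R k B"
  shows "computes R k (\<lambda>g xs. look (list_decode (A g xs)) (B g xs))"
proof (rule computes_call2[OF _ assms])
  define d where "d c i = rec_nat c (\<lambda>_ r. snd (prod_decode (r - 1))) i" for c i
  have d: "d c i = list_encode (drop i (list_decode c))" for c i
  proof (induction i)
    case 0
    then show ?case by (simp add: d_def)
  next
    case (Suc i)
    have "d c (Suc i) = snd (prod_decode (d c i - 1))" by (simp add: d_def)
    \<comment> \<open>The code 0 of the empty list is a fixed point of the iteration, as
      \<open>0 - 1 = 0\<close>.\<close>
    moreover have "prod_decode 0 = (0, 0)"
      using prod_encode_inverse[of "(0, 0)"] by (simp add: prod_encode_def)
    then have "snd (prod_decode (d c i - 1)) = list_encode (drop (Suc i) (list_decode c))"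
      unfolding Suc drop_Suc drop_tl by (cases "drop i (list_decode c)") simp_all
    ultimately show ?case by simp
  qed
  have D: "computes R 2 (\<lambda>g xs. d (xs ! 0) (xs ! 1))"
    unfolding d_def
    by (intro computes_rec computes_intros computes_prod_decode) auto
  have "computes R 2 (\<lambda>g xs. if d (xs ! 0) (xs ! 1) = 0 then 0
      else Suc (fst (prod_decode (d (xs ! 0) (xs ! 1) - 1))))"
    by (intro computes_intros computes_prod_decode D)
  moreover have "(if d c i = 0 then 0 else Suc (fst (prod_decode (d c i - 1)))) = look (list_decode c) i" for c i
    unfolding d look_def
    by (cases "i < length (list_decode c)") (simp_all add: Cons_nth_drop_Suc[symmetric])
  ultimately show "computes R 2 (\<lambda>g xs. look (list_decode (xs ! 0)) (xs ! 1))" by (simp only:)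
qed

lemma computes_length:
  assumes "computes R k A" shows "computes R k (\<lambda>g xs. length (list_decode (A g xs)))"
proof (rule computes_call1[OF _ assms])
  have "computes R 1 (\<lambda>g xs. LEAST j. look (list_decode (xs ! 0)) j = 0)"
  proof (rule computes_Least)
    show "\<exists>j. look (list_decode (xs ! 0)) j = 0" for xs :: "nat list"
      by (rule exI[of _ "length (list_decode (xs ! 0))"]) (simp add: look_def)
  qed (intro computes_intros computes_look; simp)
  moreover have "(LEAST j. look ys j = 0) = length ys" for ys
    by (rule Least_equality) (auto simp: look_def split: if_splits)
  ultimately show "computes R 1 (\<lambda>g xs. length (list_decode (xs ! 0)))" by simp
qed

lemma computes_map_upt:
  assumes N: "computes R k N" and C: "computes R k C"
    and f: "computes R (Suc k) (\<lambda>g ys. f g (ys ! 0) (tl ys))"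
  shows "computes R k (\<lambda>g xs. list_encode (map (\<lambda>i. f g i xs) [0..<N g xs] @ list_decode (C g xs)))"
proof -
  \<comment> \<open>The code has the head outermost, so the list is built from its end: after
    \<open>m\<close> steps the last \<open>m\<close> indices are done.\<close>
  define r where "r g xs n m = rec_nat (C g xs)
    (\<lambda>i c. Suc (prod_encode (f g (n - Suc i) xs, c))) m" for g xs n m
  have r: "r g xs n m = list_encode (map (\<lambda>i. f g i xs) [n - m..<n] @ list_decode (C g xs))"
    if "m \<le> n" for g xs n m
    using that
  proof (induction m)
    case 0
    then show ?case by (simp add: r_def)
  next
    case (Suc m)
    then have "[n - Suc m..<n] = (n - Suc m) # [n - m..<n]"
      by (simp add: upt_conv_Cons Suc_diff_Suc)
    with Suc show ?case by (simp add: r_def)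
  qed
  have "computes R (Suc (Suc k)) (\<lambda>g ys. N g (drop 2 ys) - Suc (ys ! 0))"
    by (intro computes_intros computes_drop N) auto
  then have "computes R (Suc (Suc k)) (\<lambda>g ys. f g (N g (drop 2 ys) - Suc (ys ! 0)) (drop 2 ys))"
    using computes_call_append[of R "[\<lambda>g ys. N g (drop 2 ys) - Suc (ys ! 0)]" k
        "\<lambda>g ys. f g (ys ! 0) (tl ys)" 2] f by simp
  then have "computes R k (\<lambda>g xs. r g xs (N g xs) (N g xs))"
    unfolding r_def by (intro computes_rec N C computes_Suc computes_prod_encode computes_nth) auto
  then show ?thesis by (simp add: r)
qed

lemma computes_snoc:
  assumes "computes R k A" "computes R k B"
  shows "computes R k (\<lambda>g xs. list_encode (list_decode (A g xs) @ [B g xs]))"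
proof (rule computes_call2[OF _ assms])
  \<comment> \<open>\<open>Suc (prod_encode (x, 0))\<close> codes \<open>[x]\<close>; the old list
    is rebuilt in front of it.\<close>
  have "computes R 2 (\<lambda>g xs. list_encode (map (\<lambda>i. look (list_decode (xs ! 0)) i - 1)
      [0..<length (list_decode (xs ! 0))] @ list_decode (Suc (prod_encode (xs ! 1, 0)))))"
    by (rule computes_map_upt)
      (intro computes_intros computes_length computes_look computes_prod_encode; simp)+
  moreover have "map (\<lambda>i. look ys i - 1) [0..<length ys] @ list_decode (Suc (prod_encode (x, 0))) = ys @ [x]"
    for ys x
    by (rule nth_equalityI) (auto simp: look_def nth_append)
  ultimately show "computes R 2 (\<lambda>g xs. list_encode (list_decode (xs ! 0) @ [xs ! 1]))" by simp
qed

section \<open>Stage approximations of an oracle computation\<close>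

text \<open>Evaluation with all searches cut off at \<open>s\<close>. The oracle \<open>h\<close> and the result are partial: \<open>0\<close>
  stands for undefined and \<open>Suc v\<close> for the value \<open>v\<close>. By recursion on the program, this is
  computable for each fixed program, so no universal program is needed.\<close>

fun stage :: "(nat \<Rightarrow> nat) \<Rightarrow> nat \<Rightarrow> prog \<Rightarrow> nat list \<Rightarrow> nat" where
  "stage h s Zero xs = 1"
| "stage h s Succ xs = (case xs of [] \<Rightarrow> 0 | x # _ \<Rightarrow> Suc (Suc x))"
| "stage h s (Proj i) xs = look xs i"
| "stage h s Oracle xs = (case xs of [] \<Rightarrow> 0 | x # _ \<Rightarrow> h x)"
| "stage h s (Comp p fs) xs = (let ys = map (\<lambda>f. stage h s f xs) fs in
    if 0 \<in> set ys then 0 else stage h s p (map (\<lambda>y. y - 1) ys))"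
| "stage h s (PrimRec p q) xs = (case xs of [] \<Rightarrow> 0 | n # zs \<Rightarrow>
    rec_nat (stage h s p zs) (\<lambda>m r. if r = 0 then 0 else stage h s q (m # (r - 1) # zs)) n)"
| "stage h s (Mu p) xs =
    rec_nat 0 (\<lambda>i r. if r \<noteq> 0 then r else
      if stage h s p (i # xs) = 0 then 1 else
      if stage h s p (i # xs) = 1 then Suc (Suc i) else 0) s - 1"

text \<open>Cutting off searches and making the oracle partial only loses values, so every
  \<open>s\<close> is sound as soon as \<open>G\<close> extends \<open>h\<close>.\<close>

lemma stage_sound:
  assumes "\<And>x v. h x = Suc v \<Longrightarrow> G x = v" "stage h s e xs = Suc y"
  shows "eval G e xs y"
  using assms(2)
proof (induction e arbitrary: xs y)
  case Zero
  then show ?case by (auto intro: eval_Zero)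
next
  case Succ
  then show ?case by (auto intro: eval_Succ split: list.splits)
next
  case (Proj i)
  then show ?case by (auto intro: eval_Proj simp: look_def split: if_splits)
next
  case Oracle
  then obtain x zs where "xs = x # zs" "h x = Suc y" by (auto split: list.splits)
  then show ?case using eval_Oracle[of G x zs] assms(1) by simp
next
  case (Comp p fs)
  let ?ys = "map (\<lambda>f. stage h s f xs) fs"
  have ys: "0 \<notin> set ?ys" and p: "stage h s p (map (\<lambda>y. y - 1) ?ys) = Suc y"
    using Comp.prems by (auto simp: Let_def split: if_splits)
  show ?case
  proof (rule eval_Comp)
    show "eval G p (map (\<lambda>y. y - 1) ?ys) y" by (rule Comp.IH(1)[OF p])
    have "eval G (fs ! i) xs (stage h s (fs ! i) xs - 1)" if "i < length fs" for i
    proof (rule Comp.IH(2))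
      show "fs ! i \<in> set fs" using that by simp
      then have "stage h s (fs ! i) xs \<noteq> 0" using ys by force
      then show "stage h s (fs ! i) xs = Suc (stage h s (fs ! i) xs - 1)" by simp
    qed
    then show "list_all2 (\<lambda>f y. eval G f xs y) fs (map (\<lambda>y. y - 1) ?ys)"
      by (simp add: list_all2_conv_all_nth)
  qed
next
  case (PrimRec p q)
  then obtain n zs where xs: "xs = n # zs" by (auto split: list.splits)
  have "eval G (PrimRec p q) (n # zs) y"
    if "rec_nat (stage h s p zs)
      (\<lambda>m r. if r = 0 then 0 else stage h s q (m # (r - 1) # zs)) n = Suc y" for n y
    using that
  proof (induction n arbitrary: y)
    case 0
    then show ?case using PrimRec.IH(1) by (auto intro: eval_PrimRec_0)
  next
    case (Suc n)
    define r where "r = rec_nat (stage h s p zs)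
      (\<lambda>m r. if r = 0 then 0 else stage h s q (m # (r - 1) # zs)) n"
    have "r \<noteq> 0" "stage h s q (n # (r - 1) # zs) = Suc y"
      using Suc.prems by (auto simp flip: r_def split: if_splits)
    then show ?case
      using Suc.IH[of "r - 1"] PrimRec.IH(2) by (auto simp flip: r_def intro: eval_PrimRec_Suc)
  qed
  then show ?case using PrimRec.prems by (simp add: xs)
next
  case (Mu p)
  \<comment> \<open>States of the search: 0 if all values so far were positive, 1 if an undefined
    value was met, \<open>Suc (Suc n)\<close> if the zero \<open>n\<close> was found. The final
    \<open>- 1\<close> in \<open>stage\<close> merges the first two.\<close>
  define r where "r = rec_nat 0 (\<lambda>i r. if r \<noteq> 0 then r else
      if stage h s p (i # xs) = 0 then 1 else
      if stage h s p (i # xs) = 1 then Suc (Suc i) else 0)"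
  have "(r t = 0 \<longrightarrow> (\<forall>i<t. stage h s p (i # xs) > 1)) \<and>
      (\<forall>n. r t = Suc (Suc n) \<longrightarrow> stage h s p (n # xs) = 1 \<and> (\<forall>i<n. stage h s p (i # xs) > 1))" for t
  proof (induction t)
    case 0
    then show ?case by (simp add: r_def)
  next
    case (Suc t)
    have "r (Suc t) = (if r t \<noteq> 0 then r t else
      if stage h s p (t # xs) = 0 then 1 else
      if stage h s p (t # xs) = 1 then Suc (Suc t) else 0)" by (simp add: r_def)
    with Suc show ?case by (auto simp: less_Suc_eq split: if_splits)
  qed
  moreover have "stage h s (Mu p) xs = r s - 1" by (simp add: r_def)
  then have "r s = Suc (Suc y)" using Mu.prems by simp
  ultimately have 0: "stage h s p (y # xs) = Suc 0" and 1: "\<forall>i<y. stage h s p (i # xs) > 1"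
    by auto
  show ?case
  proof (rule eval_Mu)
    show "eval G p (y # xs) 0" by (rule Mu.IH[OF 0])
    show "\<forall>i<y. \<exists>r. eval G p (i # xs) (Suc r)"
    proof (intro allI impI)
      fix i assume "i < y"
      with 1 have "stage h s p (i # xs) = Suc (Suc (stage h s p (i # xs) - 2))" by force
      then show "\<exists>r. eval G p (i # xs) (Suc r)" by (blast intro: Mu.IH)
    qed
  qed
qed

text \<open>Use principle: a halting computation takes finitely many steps and oracle queries, and
  \<open>b\<close> bounds both. All continuity arguments below rest on \<open>h\<close> being
  constrained below \<open>b\<close> only.\<close>

lemma stage_complete:
  assumes "eval G e xs y"
  shows "\<exists>b. \<forall>s\<ge>b. \<forall>h. (\<forall>x<b. h x = Suc (G x)) \<longrightarrow> stage h s e xs = Suc y"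
  using assms
proof (induction rule: eval.induct)
  case (eval_Oracle x xs)
  show ?case by (rule exI[of _ "Suc x"]) simp
next
  case (eval_Comp xs fs ys p z)
  obtain b where b: "\<And>s h. b \<le> s \<Longrightarrow> (\<forall>x<b. h x = Suc (G x)) \<Longrightarrow> stage h s p ys = Suc z"
    using eval_Comp.IH(2) by blast
  have len: "length fs = length ys" using eval_Comp.IH(1) by (rule list_all2_lengthD)
  have "\<forall>i<length fs. \<exists>b. \<forall>s\<ge>b. \<forall>h. (\<forall>x<b. h x = Suc (G x)) \<longrightarrow> stage h s (fs ! i) xs = Suc (ys ! i)"
    using eval_Comp.IH(1) by (auto simp: list_all2_conv_all_nth)
  then obtain c where c: "\<And>i s h. i < length fs \<Longrightarrow> c i \<le> s \<Longrightarrow> (\<forall>x<c i. h x = Suc (G x))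
      \<Longrightarrow> stage h s (fs ! i) xs = Suc (ys ! i)"
    by metis
  define m where "m = Max (insert b (c ` {..<length fs}))"
  have m: "b \<le> m" "\<And>i. i < length fs \<Longrightarrow> c i \<le> m" by (auto simp: m_def)
  have "stage h s (Comp p fs) xs = Suc z" if s: "s \<ge> m" and h: "\<forall>x<m. h x = Suc (G x)" for s h
  proof -
    have "map (\<lambda>f. stage h s f xs) fs = map Suc ys"
    proof (rule nth_equalityI)
      fix i assume "i < length (map (\<lambda>f. stage h s f xs) fs)"
      then have i: "i < length fs" by simp
      have "stage h s (fs ! i) xs = Suc (ys ! i)"
        by (rule c[OF i]) (use m(2)[OF i] s h in auto)
      then show "map (\<lambda>f. stage h s f xs) fs ! i = map Suc ys ! i" using i len by simp
    qed (simp add: len)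
    moreover have "stage h s p ys = Suc z" by (rule b) (use m(1) s h in auto)
    ultimately show ?thesis by (auto simp: Let_def comp_def)
  qed
  then show ?case by blast
next
  case (eval_PrimRec_Suc p q n xs r y)
  obtain b c where b: "\<And>s h. b \<le> s \<Longrightarrow> (\<forall>x<b. h x = Suc (G x)) \<Longrightarrow> stage h s (PrimRec p q) (n # xs) = Suc r"
    and c: "\<And>s h. c \<le> s \<Longrightarrow> (\<forall>x<c. h x = Suc (G x)) \<Longrightarrow> stage h s q (n # r # xs) = Suc y"
    using eval_PrimRec_Suc.IH by blast
  show ?case by (rule exI[of _ "max b c"]) (use b c in auto)
next
  case (eval_Mu p n xs)
  obtain b where b: "\<And>s h. b \<le> s \<Longrightarrow> (\<forall>x<b. h x = Suc (G x)) \<Longrightarrow> stage h s p (n # xs) = Suc 0"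
    using eval_Mu.IH(1) by blast
  have "\<forall>i<n. \<exists>c. \<forall>s\<ge>c. \<forall>h. (\<forall>x<c. h x = Suc (G x)) \<longrightarrow> stage h s p (i # xs) > 1"
    using eval_Mu.IH(2) by (metis One_nat_def Suc_less_eq zero_less_Suc)
  then obtain c where c: "\<And>i s h. i < n \<Longrightarrow> c i \<le> s \<Longrightarrow> (\<forall>x<c i. h x = Suc (G x))
      \<Longrightarrow> stage h s p (i # xs) > 1"
    by metis
  \<comment> \<open>\<open>Suc n\<close> is included because the search with cut-off
    \<open>s\<close> tries only \<open>i < s\<close>.\<close>
  define m where "m = Max (insert (Suc n) (insert b (c ` {..<n})))"
  have m: "b \<le> m" "n < m" "\<And>i. i < n \<Longrightarrow> c i \<le> m"
    unfolding m_def Suc_le_eq[symmetric] by (rule Max_ge; simp)+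
  have "stage h s (Mu p) xs = Suc n" if s: "s \<ge> m" and h: "\<forall>x<m. h x = Suc (G x)" for s h
  proof -
    define r where "r = rec_nat 0 (\<lambda>i r. if r \<noteq> 0 then r else
      if stage h s p (i # xs) = 0 then 1 else
      if stage h s p (i # xs) = 1 then Suc (Suc i) else 0)"
    have r_Suc: "r (Suc t) = (if r t \<noteq> 0 then r t else
      if stage h s p (t # xs) = 0 then 1 else
      if stage h s p (t # xs) = 1 then Suc (Suc t) else 0)" for t by (simp add: r_def)
    have "stage h s p (i # xs) > 1" if "i < n" for i
      by (rule c[OF that]) (use m(3)[OF that] s h in auto)
    then have p: "stage h s p (i # xs) \<noteq> 0 \<and> stage h s p (i # xs) \<noteq> 1" if "i < n" for i
      using that by fastforce
    have "t \<le> n \<Longrightarrow> r t = 0" for t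
    proof (induction t)
      case 0
      then show ?case by (simp add: r_def)
    next
      case (Suc t)
      then show ?case using p[of t] by (simp add: r_Suc)
    qed
    moreover have "stage h s p (n # xs) = Suc 0" by (rule b) (use m(1) s h in auto)
    ultimately have "r (Suc n) = Suc (Suc n)" by (simp add: r_Suc)
    then have "r (Suc n + d) = Suc (Suc n)" for d by (induction d) (auto simp: r_Suc)
    from this[of "s - Suc n"] have "r s = Suc (Suc n)" using m(2) s by simp
    moreover have "stage h s (Mu p) xs = r s - 1" by (simp add: r_def)
    ultimately show ?thesis by simp
  qed
  then show ?case by blast
qed (auto simp: look_def)

lemma decides_zero_mem:
  assumes "\<And>F. F \<in> set Fs \<Longrightarrow> computes R k F"
  shows "decides R k (\<lambda>g xs. 0 \<in> set (map (\<lambda>F. F g xs) Fs))"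
  using assms
proof (induction Fs)
  case Nil
  have "decides R k (\<lambda>g xs. (1::nat) = 0)" by (intro computes_intros)
  then show ?case by simp
next
  case (Cons F Fs)
  have "decides R k (\<lambda>g xs. \<not> (\<not> F g xs = 0 \<and> \<not> 0 \<in> set (map (\<lambda>F. F g xs) Fs)))"
    using Cons by (intro computes_intros) auto
  then show ?case by (rule decides_cong) auto
qed

text \<open>The arguments are the cut-off, a number selecting the oracle, and the arguments of
  \<open>e\<close>. The selecting number lets later searches pass finite partial oracles as
  codes.\<close>

lemma computes_stage:
  assumes "computes R 2 (\<lambda>g ys. h g (ys ! 0) (ys ! 1))"
  shows "computes R (Suc (Suc k)) (\<lambda>g ys. stage (h g (ys ! 1)) (ys ! 0) e (drop 2 ys))"
proof (induction e arbitrary: k)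
  case Zero
  show ?case by (simp add: computes_const)
next
  case Succ
  have "computes R (Suc (Suc k)) (\<lambda>g ys. if k = 0 then 0 else Suc (Suc (ys ! 2)))"
    by (cases "k = 0") (auto intro!: computes_intros)
  then show ?case
    by (rule computes_cong) (auto simp: numeral_eq_Suc length_Suc_conv split: list.splits)
next
  case (Proj i)
  have "computes R (Suc (Suc k)) (\<lambda>g ys. if i < k then Suc (ys ! (i + 2)) else 0)"
    by (cases "i < k") (auto intro!: computes_intros)
  then show ?case by (rule computes_cong) (auto simp: look_def add.commute)
next
  case Oracle
  have "computes R (Suc (Suc k)) (\<lambda>g ys. if k = 0 then 0 else h g (ys ! 1) (ys ! 2))"
    by (cases "k = 0") (auto intro!: computes_const computes_call2[OF assms] computes_nth)
  then show ?case
    by (rule computes_cong) (auto simp: numeral_eq_Suc length_Suc_conv split: list.splits)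
next
  case (Comp p fs)
  define F where "F = (\<lambda>f g ys. stage (h g (ys ! 1)) (ys ! 0) f (drop 2 ys))"
  have F: "computes R (Suc (Suc k)) (F f)" if "f \<in> set fs" for f
    using Comp.IH(2)[OF that] by (simp add: F_def)
  have "decides R (Suc (Suc k)) (\<lambda>g ys. 0 \<in> set (map (\<lambda>F. F g ys) (map F fs)))"
    by (rule decides_zero_mem) (auto intro: F)
  moreover have "computes R (Suc (Suc k)) (\<lambda>g ys. F p g (map (\<lambda>F. F g ys)
      ((\<lambda>g ys. ys ! 0) # (\<lambda>g ys. ys ! 1) # map (\<lambda>f g ys. F f g ys - 1) fs)))"
  proof (rule computes_call)
    show "computes R (length ((\<lambda>g ys. ys ! 0) # (\<lambda>g ys. ys ! 1) # map (\<lambda>f g ys. F f g ys - 1) fs)) (F p)"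
      using Comp.IH(1)[of "length fs"] by (simp add: F_def)
  qed (auto intro!: computes_nth computes_diff computes_const F)
  ultimately have "computes R (Suc (Suc k)) (\<lambda>g ys. if 0 \<in> set (map (\<lambda>F. F g ys) (map F fs)) then 0 else
      F p g (map (\<lambda>F. F g ys) ((\<lambda>g ys. ys ! 0) # (\<lambda>g ys. ys ! 1) # map (\<lambda>f g ys. F f g ys - 1) fs)))"
    by (intro computes_if computes_const)
  then show ?case by (rule computes_cong) (simp add: F_def Let_def comp_def)
next
  case (PrimRec p q)
  show ?case
  proof (cases k)
    case 0
    show ?thesis by (rule computes_cong[OF computes_const[of R _ 0]]) (simp add: 0)
  next
    case (Suc j)
    define F where "F = (\<lambda>f g ys. stage (h g (ys ! 1)) (ys ! 0) f (drop 2 ys))"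
    \<comment> \<open>\<open>F p\<close> must skip the recursion argument \<open>ys ! 2\<close>. In
      the recursive step counter and accumulator come first and have to move behind cut-off and
      selector.\<close>
    let ?a = "[\<lambda>g ys. ys ! 0, \<lambda>g ys. ys ! 1]"
    let ?b = "[\<lambda>g ys. ys ! 2, \<lambda>g ys. ys ! 3, \<lambda>g ys. ys ! 0, \<lambda>g ys. ys ! 1 - 1]"
    have "computes R (Suc (Suc j)) (F p)" using PrimRec.IH(1) by (simp add: F_def)
    then have p: "computes R (3 + j) (\<lambda>g ys. F p g (map (\<lambda>F. F g ys) ?a @ drop 3 ys))"
      by (intro computes_call_append) (auto intro: computes_nth)
    have "computes R (Suc (Suc (Suc (Suc j)))) (F q)" using PrimRec.IH(2) by (simp add: F_def)
    then have q: "computes R (5 + j) (\<lambda>g ys. F q g (map (\<lambda>F. F g ys) ?b @ drop 5 ys))"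
      by (intro computes_call_append) (auto intro!: computes_nth computes_diff computes_const)
    have "computes R (3 + j) (\<lambda>g ys. rec_nat (F p g (map (\<lambda>F. F g ys) ?a @ drop 3 ys))
        (\<lambda>m r. if r = 0 then 0 else F q g (ys ! 0 # ys ! 1 # m # (r - 1) # drop 3 ys)) (ys ! 2))"
    proof (intro computes_rec computes_if decides_eq computes_const p)
      show "computes R (Suc (Suc (3 + j))) (\<lambda>g ys. F q g
          (drop 2 ys ! 0 # drop 2 ys ! 1 # ys ! 0 # (ys ! 1 - 1) # drop 3 (drop 2 ys)))"
        using computes_cong[OF q, of "\<lambda>g ys. F q g
          (drop 2 ys ! 0 # drop 2 ys ! 1 # ys ! 0 # (ys ! 1 - 1) # drop 3 (drop 2 ys))"]
        by (simp add: numeral_eq_Suc)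
    qed (auto intro: computes_nth)
    then have "computes R (3 + j) (\<lambda>g ys. stage (h g (ys ! 1)) (ys ! 0) (PrimRec p q) (drop 2 ys))"
    proof (rule computes_cong)
      fix g and ys :: "nat list" assume "length ys = 3 + j"
      then obtain s c n zs where "ys = s # c # n # zs"
        by (auto simp: numeral_eq_Suc length_Suc_conv)
      then show "rec_nat (F p g (map (\<lambda>F. F g ys) ?a @ drop 3 ys))
        (\<lambda>m r. if r = 0 then 0 else F q g (ys ! 0 # ys ! 1 # m # (r - 1) # drop 3 ys)) (ys ! 2) =
        stage (h g (ys ! 1)) (ys ! 0) (PrimRec p q) (drop 2 ys)"
        by (simp add: F_def cong: if_cong)
    qed
    then show ?thesis by (simp add: Suc numeral_eq_Suc)
  qed
next
  case (Mu p)
  define F where "F = (\<lambda>f g ys. stage (h g (ys ! 1)) (ys ! 0) f (drop 2 ys))"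
  have "computes R (Suc (Suc (Suc k))) (F p)" using Mu.IH by (simp add: F_def)
  then have "computes R (4 + k) (\<lambda>g ys. F p g (map (\<lambda>F. F g ys)
      [\<lambda>g ys. ys ! 2, \<lambda>g ys. ys ! 3, \<lambda>g ys. ys ! 0] @ drop 4 ys))"
    by (intro computes_call_append) (auto intro!: computes_nth)
  then have p: "computes R (Suc (Suc (Suc (Suc k)))) (\<lambda>g ys. F p g
      (drop 2 ys ! 0 # drop 2 ys ! 1 # ys ! 0 # drop 2 (drop 2 ys)))"
    using computes_cong[of R "4 + k" _ "\<lambda>g ys. F p g
      (drop 2 ys ! 0 # drop 2 ys ! 1 # ys ! 0 # drop 2 (drop 2 ys))"] by (simp add: numeral_eq_Suc)
  have "computes R (Suc (Suc k)) (\<lambda>g ys. rec_nat 0 (\<lambda>i r. if \<not> r = 0 then r else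
      if F p g (ys ! 0 # ys ! 1 # i # drop 2 ys) = 0 then 1 else
      if F p g (ys ! 0 # ys ! 1 # i # drop 2 ys) = 1 then Suc (Suc i) else 0) (ys ! 0) - 1)"
    by (intro computes_diff computes_rec computes_if decides_eq decides_not computes_const p
        computes_Suc computes_nth) auto
  then show ?case by (rule computes_cong) (simp add: F_def cong: if_cong)
qed

section \<open>Compactness\<close>

lemma map_upt_eq:
  assumes "s 0 = []" "\<And>k. s (Suc k) = s k @ [x k]"
  shows "map x [0..<n] = s n"
  by (induction n) (simp_all add: assms)

text \<open>Weak Koenig's lemma: always move to a child with arbitrarily long extensions in
  \<open>B\<close>, to 0 if possible. It is applied to the strings that carry too little information
  for a computation.\<close>

lemma koenig:
  assumes "B \<subseteq> lists {0, 1}"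
    and closed: "\<And>\<sigma> \<tau>. \<sigma> \<in> B \<Longrightarrow> Sublist.prefix \<tau> \<sigma> \<Longrightarrow> \<tau> \<in> B"
    and inf: "\<And>n. \<exists>\<sigma>\<in>B. n \<le> length \<sigma>"
  shows "paths B \<noteq> {}"
proof -
  define I where "I \<sigma> \<longleftrightarrow> (\<forall>n. \<exists>\<tau>\<in>B. Sublist.prefix \<sigma> \<tau> \<and> n \<le> length \<tau>)" for \<sigma>
  define s where "s = rec_nat [] (\<lambda>_ \<sigma>. \<sigma> @ [if I (\<sigma> @ [0]) then 0 else 1])"
  have split: "I (\<sigma> @ [1])" if "I \<sigma>" "\<not> I (\<sigma> @ [0])" for \<sigma>
  proof -
    \<comment> \<open>The extensions of \<open>\<sigma> @ [0]\<close> in \<open>B\<close> are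
      shorter than \<open>m\<close>, so longer extensions of \<open>\<sigma>\<close> pass through
      \<open>\<sigma> @ [1]\<close>.\<close>
    obtain m where m: "\<And>\<tau>. \<tau> \<in> B \<Longrightarrow> Sublist.prefix (\<sigma> @ [0]) \<tau> \<Longrightarrow> length \<tau> < m"
      using \<open>\<not> I (\<sigma> @ [0])\<close> by (force simp: I_def not_le)
    show ?thesis
      unfolding I_def
    proof
      fix n
      obtain \<tau> where \<tau>: "\<tau> \<in> B" "Sublist.prefix \<sigma> \<tau>" "max (Suc (length \<sigma>)) (max m n) \<le> length \<tau>"
        using \<open>I \<sigma>\<close> unfolding I_def by blast
      then obtain \<upsilon>' where \<upsilon>': "\<tau> = \<sigma> @ \<upsilon>'" by (auto simp: prefix_def)
      with \<tau>(3) obtain x \<upsilon> where x: "\<tau> = \<sigma> @ x # \<upsilon>"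
        by (cases \<upsilon>') auto
      have "x \<in> {0, 1}" using \<tau>(1) assms(1) by (auto simp: x)
      moreover have "x \<noteq> 0" using m[OF \<tau>(1)] \<tau>(3) by (auto simp: x)
      ultimately show "\<exists>\<tau>\<in>B. Sublist.prefix (\<sigma> @ [1]) \<tau> \<and> n \<le> length \<tau>"
        using \<tau> by (intro bexI[of _ \<tau>]) (auto simp: x)
    qed
  qed
  have "I (s k)" for k
  proof (induction k)
    case 0
    then show ?case using inf by (simp add: s_def I_def)
  next
    case (Suc k)
    then show ?case using split[of "s k"] by (simp add: s_def)
  qed
  then have "s k \<in> B" for k
    using closed unfolding I_def by blast
  moreover have "map (\<lambda>k. if I (s k @ [0]) then 0 else 1) [0..<n] = s n" for n
    by (rule map_upt_eq) (simp_all add: s_def)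
  ultimately have "(\<lambda>k. if I (s k @ [0]) then 0 else 1) \<in> paths B"
    unfolding paths_def by simp
  then show ?thesis by blast
qed

text \<open>If \<open>f\<close> were outside \<open>P\<close>, some computation would answer 0 after
  reading finitely many values of \<open>f\<close>; a member of \<open>P\<close> sharing these
  values would get the same answer.\<close>

lemma pi01_closed:
  assumes "pi01 P" and "\<And>n. \<exists>f'\<in>P. \<forall>i<n. f' i = f i"
  shows "f \<in> P"
proof -
  obtain S e where P: "P = {f. \<forall>n. S f n}" and e: "\<And>f n. eval f e [n] (if S f n then 1 else 0)"
    using assms(1) unfolding pi01_def computable_rel_def by blast
  have "S f n" for n
  proof (rule ccontr)
    assume "\<not> S f n"
    then have "eval f e [n] 0" using e[of f n] by simp
    from stage_complete[OF this] obtain b where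
      b: "\<And>h. (\<forall>x<b. h x = Suc (f x)) \<Longrightarrow> stage h b e [n] = Suc 0" by blast
    obtain f' where f': "f' \<in> P" "\<forall>i<b. f' i = f i" using assms(2) by blast
    have "eval f' e [n] 0"
      by (rule stage_sound[of "\<lambda>x. Suc (f' x)" _ b]) (auto simp: f'(2) b)
    moreover have "eval f' e [n] 1" using e[of f' n] f'(1) by (simp add: P)
    ultimately show False by (auto dest: eval_deterministic)
  qed
  then show ?thesis unfolding P by blast
qed

section \<open>Nested evaluations along a sequence of leaves\<close>

text \<open>The partial oracle \<open>(\<rho> \<frown> t) \<oplus> g\<close>, where \<open>t\<close> is partial in the sense of \<^const>\<open>stage\<close>.\<close>

definition partial_oracle :: "(nat \<Rightarrow> nat) \<Rightarrow> nat list \<Rightarrow> (nat \<Rightarrow> nat) \<Rightarrow> nat \<Rightarrow> nat" where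
  "partial_oracle g \<rho> t x = (if even x then
     if x div 2 < length \<rho> then Suc (\<rho> ! (x div 2)) else t (x div 2 - length \<rho>)
   else Suc (g (x div 2)))"

text \<open>One application of \<open>\<Phi> (\<rho> \<frown> f)\<close> to a partial
  \<open>f\<close>. The guard \<open>i < s\<close> keeps the result finite, so that a list can code
  it.\<close>

definition leaf_step :: "(nat \<Rightarrow> nat) \<Rightarrow> prog \<Rightarrow> nat \<Rightarrow> nat list \<Rightarrow> (nat \<Rightarrow> nat) \<Rightarrow> nat \<Rightarrow> nat" where
  "leaf_step g e s \<rho> t i = (if i < s then stage (partial_oracle g \<rho> t) s e [i] else 0)"

definition approx :: "(nat \<Rightarrow> nat) \<Rightarrow> (nat \<Rightarrow> nat) \<Rightarrow> bool" where
  "approx t f \<longleftrightarrow> (\<forall>i v. t i = Suc v \<longrightarrow> f i = v)"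

locale cupping =
  fixes P :: "(nat \<Rightarrow> nat) set" and T :: "nat list set" and g :: "nat \<Rightarrow> nat" and e :: prog
    and \<Phi> :: "(nat \<Rightarrow> nat) \<Rightarrow> nat \<Rightarrow> nat"
  assumes P_pi01: "pi01 P" and P_cantor: "P \<subseteq> cantor" and P_nonempty: "P \<noteq> {}"
    and tree: "computable_binary_tree T"
    and \<Phi>_P: "f \<in> concatenation T P \<Longrightarrow> \<Phi> f \<in> P"
    and \<Phi>_eval: "f \<in> concatenation T P \<Longrightarrow> eval (f \<oplus> g) e [n] (\<Phi> f n)"
begin

lemma leaf_conc: "\<rho> \<in> leaves T \<Longrightarrow> f \<in> P \<Longrightarrow> \<rho> \<frown> f \<in> concatenation T P"
  unfolding concatenation_def by blast

lemma approx_leaf_step: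
  assumes "\<rho> \<in> leaves T" "f \<in> P" "approx t f"
  shows "approx (leaf_step g e s \<rho> t) (\<Phi> (\<rho> \<frown> f))"
  unfolding approx_def
proof (intro allI impI)
  fix i v assume "leaf_step g e s \<rho> t i = Suc v"
  then have *: "stage (partial_oracle g \<rho> t) s e [i] = Suc v" by (simp add: leaf_step_def split: if_splits)
  have "eval ((\<rho> \<frown> f) \<oplus> g) e [i] v"
  proof (rule stage_sound[OF _ *])
    show "((\<rho> \<frown> f) \<oplus> g) x = v" if "partial_oracle g \<rho> t x = Suc v" for x v
      using that assms(3) by (auto simp: partial_oracle_def join_def conc_def approx_def split: if_splits)
  qed
  then show "\<Phi> (\<rho> \<frown> f) i = v"
    using \<Phi>_eval[OF leaf_conc[OF assms(1,2)]] by (rule eval_deterministic[symmetric])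
qed

lemma stage_total:
  assumes "f \<in> concatenation T P"
  shows "\<exists>b. \<forall>s\<ge>b. \<forall>h. (\<forall>x<b. h x = Suc ((f \<oplus> g) x)) \<longrightarrow> (\<forall>i<l. stage h s e [i] \<noteq> 0)"
proof (induction l)
  case (Suc l)
  then obtain b where b: "\<And>s h i. b \<le> s \<Longrightarrow> (\<forall>x<b. h x = Suc ((f \<oplus> g) x)) \<Longrightarrow> i < l
    \<Longrightarrow> stage h s e [i] \<noteq> 0" by blast
  obtain c where c: "\<And>s h. c \<le> s \<Longrightarrow> (\<forall>x<c. h x = Suc ((f \<oplus> g) x))
    \<Longrightarrow> stage h s e [l] = Suc (\<Phi> f l)"
    using stage_complete[OF \<Phi>_eval[OF assms, of l]] by blast
  show ?case
  proof (intro exI[of _ "max b c"] allI impI)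
    fix s h i assume "max b c \<le> s" "\<forall>x<max b c. h x = Suc ((f \<oplus> g) x)" "i < Suc l"
    then show "stage h s e [i] \<noteq> 0" using b[of s h i] c[of s h] by (auto simp: less_Suc_eq)
  qed
qed simp

lemma leaf_step_total:
  assumes "f \<in> concatenation T P"
  shows "\<exists>b. \<forall>s\<ge>b. \<forall>\<rho> t. (\<forall>x<b. partial_oracle g \<rho> t x = Suc ((f \<oplus> g) x)) \<longrightarrow> (\<forall>i<l. leaf_step g e s \<rho> t i \<noteq> 0)"
proof -
  obtain b where b: "\<And>s h i. b \<le> s \<Longrightarrow> (\<forall>x<b. h x = Suc ((f \<oplus> g) x)) \<Longrightarrow> i < l
    \<Longrightarrow> stage h s e [i] \<noteq> 0" using stage_total[OF assms, of l] by blast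
  show ?thesis
    \<comment> \<open>The maximum with \<open>l\<close> satisfies the guard \<open>i < s\<close> of
      \<open>leaf_step\<close>.\<close>
    by (rule exI[of _ "max b l"]) (auto simp: leaf_step_def b)
qed

text \<open>Compactness of \<open>P\<close>: if no \<open>N\<close> worked, the insufficient
  segments of members of \<open>P\<close> would form an infinite tree. A path through it lies in
  \<open>P\<close>, yet a finite segment of it suffices for its own computation. Only
  \<open>N\<close> is uniform; the stage \<open>b\<close> depends on \<open>f\<close>.\<close>

lemma leaf_step_use:
  assumes \<rho>: "\<rho> \<in> leaves T"
  shows "\<exists>N. \<forall>f\<in>P. \<exists>b. \<forall>s\<ge>b. \<forall>t. (\<forall>i<N. t i = Suc (f i)) \<longrightarrow> (\<forall>i<l. leaf_step g e s \<rho> t i \<noteq> 0)"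
proof (rule ccontr)
  define ok where "ok \<sigma> \<longleftrightarrow> (\<exists>b. \<forall>s\<ge>b. \<forall>t. (\<forall>i<length \<sigma>. t i = Suc (\<sigma> ! i)) \<longrightarrow>
    (\<forall>i<l. leaf_step g e s \<rho> t i \<noteq> 0))" for \<sigma> :: "nat list"
  define B where "B = {map f [0..<n] | f n. f \<in> P \<and> \<not> ok (map f [0..<n])}"
  assume neg: "\<not> ?thesis"
  have "paths B \<noteq> {}"
  proof (rule koenig)
    show "B \<subseteq> lists {0, 1}" using P_cantor by (force simp: B_def cantor_def)
    show "\<tau> \<in> B" if \<sigma>: "\<sigma> \<in> B" "Sublist.prefix \<tau> \<sigma>" for \<sigma> \<tau>
    proof -
      from \<sigma>(1) obtain f n where f: "\<sigma> = map f [0..<n]" "f \<in> P" "\<not> ok \<sigma>" by (auto simp: B_def)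
      from \<sigma>(2) have len: "length \<tau> \<le> n" by (auto dest: prefix_length_le simp: f)
      have \<tau>: "\<tau> = map f [0..<length \<tau>]"
        using \<sigma>(2) len by (auto simp: f take_map dest!: prefix_def[THEN iffD1] intro!: nth_equalityI)
          (metis add.left_neutral diff_zero length_map length_upt nth_append nth_map nth_upt order_less_le_trans)
      have "\<not> ok \<tau>"
      proof
        assume "ok \<tau>"
        then obtain b where b: "\<And>s t. b \<le> s \<Longrightarrow> (\<forall>i<length \<tau>. t i = Suc (\<tau> ! i)) \<Longrightarrow>
          (\<forall>i<l. leaf_step g e s \<rho> t i \<noteq> 0)" unfolding ok_def by blast
        have "\<tau> ! i = \<sigma> ! i" if "i < length \<tau>" for i
          using \<sigma>(2) that by (auto simp: prefix_def nth_append)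
        then have "ok \<sigma>" unfolding ok_def
          by (intro exI[of _ b] allI impI) (use b len in \<open>force simp: f(1)\<close>)
        then show False using f(3) by simp
      qed
      then have "\<not> ok (map f [0..<length \<tau>])" using arg_cong[OF \<tau>, of ok] by blast
      with f(2) have "map f [0..<length \<tau>] \<in> B" unfolding B_def by blast
      then show ?thesis using arg_cong[OF \<tau>, of "\<lambda>\<tau>. \<tau> \<in> B"] by blast
    qed
    show "\<exists>\<sigma>\<in>B. n \<le> length \<sigma>" for n
    proof -
      have "\<not> (\<forall>f\<in>P. ok (map f [0..<n]))"
      proof
        assume "\<forall>f\<in>P. ok (map f [0..<n])"
        then have "\<forall>f\<in>P. \<exists>b. \<forall>s\<ge>b. \<forall>t. (\<forall>i<n. t i = Suc (f i)) \<longrightarrow> (\<forall>i<l. leaf_step g e s \<rho> t i \<noteq> 0)"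
          by (simp add: ok_def)
        with neg show False by (rule notE[OF _ exI])
      qed
      then obtain f where "f \<in> P" "\<not> ok (map f [0..<n])" by blast
      then have "map f [0..<n] \<in> B" unfolding B_def by blast
      then show ?thesis by force
    qed
  qed
  then obtain f where f: "\<And>n. map f [0..<n] \<in> B" by (auto simp: paths_def)
  have "f \<in> P"
  proof (rule pi01_closed[OF P_pi01])
    fix n
    obtain f' m where f': "f' \<in> P" "map f [0..<n] = map f' [0..<m]"
      using f[of n] by (auto simp: B_def)
    from f'(2) have "m = n" using map_eq_imp_length_eq by fastforce
    with f' show "\<exists>f'\<in>P. \<forall>i<n. f' i = f i" by (intro bexI[of _ f']) auto
  qed
  from leaf_step_total[OF leaf_conc[OF \<rho> this], of l] obtain b where
    b: "\<And>s t. b \<le> s \<Longrightarrow> (\<forall>x<b. partial_oracle g \<rho> t x = Suc (((\<rho> \<frown> f) \<oplus> g) x)) \<Longrightarrow> (\<forall>i<l. leaf_step g e s \<rho> t i \<noteq> 0)"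
    by blast
  have "ok (map f [0..<b])"
    unfolding ok_def
  proof (rule exI[of _ b], intro allI impI)
    fix s t i assume *: "b \<le> s" "\<forall>i<length (map f [0..<b]). t i = Suc (map f [0..<b] ! i)" "i < l"
    have "partial_oracle g \<rho> t x = Suc (((\<rho> \<frown> f) \<oplus> g) x)" if "x < b" for x
    proof -
      have "x div 2 - length \<rho> < b"
        by (rule le_less_trans[OF order_trans[OF diff_le_self div_le_dividend] that])
      then have "t (x div 2 - length \<rho>) = Suc (f (x div 2 - length \<rho>))" using *(2) by simp
      then show ?thesis by (simp add: partial_oracle_def join_def conc_def)
    qed
    with b * show "leaf_step g e s \<rho> t i \<noteq> 0" by blast
  qed
  moreover have "\<not> ok (map f [0..<b])" using f[of b] by (auto simp: B_def)
  ultimately show False by simp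
qed

text \<open>The head of \<open>\<rho>s\<close> is the innermost leaf in both of the following.\<close>

abbreviation iter :: "nat \<Rightarrow> nat list list \<Rightarrow> (nat \<Rightarrow> nat) \<Rightarrow> nat \<Rightarrow> nat" where
  "iter s \<rho>s t \<equiv> fold (leaf_step g e s) \<rho>s t"

abbreviation nest :: "nat list list \<Rightarrow> (nat \<Rightarrow> nat) \<Rightarrow> nat \<Rightarrow> nat" where
  "nest \<rho>s f \<equiv> fold (\<lambda>\<rho> f. \<Phi> (\<rho> \<frown> f)) \<rho>s f"

lemma nest_P: "set \<rho>s \<subseteq> leaves T \<Longrightarrow> f \<in> P \<Longrightarrow> nest \<rho>s f \<in> P"
  by (induction \<rho>s arbitrary: f) (auto intro: \<Phi>_P leaf_conc)

lemma approx_iter: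
  "set \<rho>s \<subseteq> leaves T \<Longrightarrow> f \<in> P \<Longrightarrow> approx t f \<Longrightarrow> approx (iter s \<rho>s t) (nest \<rho>s f)"
  by (induction \<rho>s arbitrary: f t) (auto intro: \<Phi>_P leaf_conc approx_leaf_step)

text \<open>Uses compose: the outer leaves need \<open>N1\<close> values of their argument, which
  \<open>leaf_step_use\<close> turns into \<open>N\<close> values of the innermost one. The
  induction hypothesis is applied at \<open>\<Phi> (\<rho> \<frown> f)\<close>, again a member of
  \<open>P\<close>.\<close>

lemma iter_use:
  assumes "set \<rho>s \<subseteq> leaves T"
  shows "\<exists>N. \<forall>f\<in>P. \<exists>b. \<forall>s\<ge>b. \<forall>t. approx t f \<and> (\<forall>i<N. t i \<noteq> 0) \<longrightarrow> (\<forall>i<l. iter s \<rho>s t i \<noteq> 0)"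
  using assms
proof (induction \<rho>s)
  case Nil
  show ?case by auto
next
  case (Cons \<rho> \<rho>s)
  then have \<rho>: "\<rho> \<in> leaves T" by simp
  obtain N1 where N1: "\<forall>f\<in>P. \<exists>b. \<forall>s\<ge>b. \<forall>t. approx t f \<and> (\<forall>i<N1. t i \<noteq> 0) \<longrightarrow> (\<forall>i<l. iter s \<rho>s t i \<noteq> 0)"
    using Cons by auto
  obtain N where N: "\<forall>f\<in>P. \<exists>b. \<forall>s\<ge>b. \<forall>t. (\<forall>i<N. t i = Suc (f i)) \<longrightarrow> (\<forall>i<N1. leaf_step g e s \<rho> t i \<noteq> 0)"
    using leaf_step_use[OF \<rho>] by blast
  show ?case
  proof (rule exI[of _ N], rule ballI)
    fix f assume f: "f \<in> P"
    obtain b where b: "\<And>s t. b \<le> s \<Longrightarrow> (\<forall>i<N. t i = Suc (f i)) \<Longrightarrow> (\<forall>i<N1. leaf_step g e s \<rho> t i \<noteq> 0)"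
      using N f by blast
    obtain c where c: "\<And>s t. c \<le> s \<Longrightarrow> approx t (\<Phi> (\<rho> \<frown> f)) \<Longrightarrow> (\<forall>i<N1. t i \<noteq> 0) \<Longrightarrow>
        (\<forall>i<l. iter s \<rho>s t i \<noteq> 0)"
      using N1 \<Phi>_P[OF leaf_conc[OF \<rho> f]] by blast
    show "\<exists>b. \<forall>s\<ge>b. \<forall>t. approx t f \<and> (\<forall>i<N. t i \<noteq> 0) \<longrightarrow> (\<forall>i<l. iter s (\<rho> # \<rho>s) t i \<noteq> 0)"
    proof (rule exI[of _ "max b c"], rule allI, rule impI, rule allI, rule impI)
      fix s t assume s: "max b c \<le> s" and t: "approx t f \<and> (\<forall>i<N. t i \<noteq> 0)"
      then have "\<forall>i<N. t i = Suc (f i)"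
        unfolding approx_def by (metis not0_implies_Suc)
      with b s have "\<forall>i<N1. leaf_step g e s \<rho> t i \<noteq> 0" by simp
      with c s approx_leaf_step[OF \<rho> f] t show "\<forall>i<l. iter s (\<rho> # \<rho>s) t i \<noteq> 0" by simp
    qed
  qed
qed

text \<open>Compactness of the paths: a path through the insufficient strings would lie in
  \<open>concatenation T P\<close>, where the functional is total. So these strings have bounded
  length, and any longer leaf is as required.\<close>

lemma total_leaf_exists:
  assumes "\<And>n. \<exists>\<rho>\<in>leaves T. n \<le> length \<rho>"
  shows "\<exists>\<rho>\<in>leaves T. \<exists>b. \<forall>s\<ge>b. \<forall>t. \<forall>i<N. leaf_step g e s \<rho> t i \<noteq> 0"
proof -
  define ok where "ok \<rho> \<longleftrightarrow> (\<exists>b. \<forall>s\<ge>b. \<forall>t. \<forall>i<N. leaf_step g e s \<rho> t i \<noteq> 0)" for \<rho>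
  have "paths {\<sigma> \<in> T. \<not> ok \<sigma>} = {}"
  proof (rule ccontr)
    assume "paths {\<sigma> \<in> T. \<not> ok \<sigma>} \<noteq> {}"
    then obtain f where f: "\<And>n. map f [0..<n] \<in> T" "\<And>n. \<not> ok (map f [0..<n])"
      by (auto simp: paths_def)
    then have "f \<in> concatenation T P" by (auto simp: concatenation_def paths_def)
    from leaf_step_total[OF this, of N] obtain b where b: "\<And>s \<rho> t. b \<le> s \<Longrightarrow> (\<forall>x<b. partial_oracle g \<rho> t x = Suc ((f \<oplus> g) x))
      \<Longrightarrow> (\<forall>i<N. leaf_step g e s \<rho> t i \<noteq> 0)" by blast
    have "partial_oracle g (map f [0..<b]) t x = Suc ((f \<oplus> g) x)" if "x < b" for t x
      using le_less_trans[OF div_le_dividend that, of 2] by (simp add: partial_oracle_def join_def)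
    with b have "ok (map f [0..<b])" unfolding ok_def by blast
    with f(2) show False by blast
  qed
  moreover have "\<tau> \<in> {\<sigma> \<in> T. \<not> ok \<sigma>}" 
    if \<sigma>: "\<sigma> \<in> {\<sigma> \<in> T. \<not> ok \<sigma>}" "Sublist.prefix \<tau> \<sigma>" for \<sigma> \<tau>
  proof -
    obtain \<upsilon> where \<upsilon>: "\<sigma> = \<tau> @ \<upsilon>" using \<sigma>(2) by (auto simp: prefix_def)
    \<comment> \<open>The end of \<open>\<sigma>\<close> is read as part of the tail behind
      \<open>\<tau>\<close>; since \<open>ok\<close> ranges over all tails, it passes from
      \<open>\<tau>\<close> to \<open>\<sigma>\<close>.\<close>
    have "partial_oracle g \<sigma> t = partial_oracle g \<tau> (\<lambda>i. if i < length \<upsilon> then Suc (\<upsilon> ! i) else t (i - length \<upsilon>))" for t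
      by (rule ext) (auto simp: partial_oracle_def \<upsilon> nth_append)
    then have "ok \<sigma>" if "ok \<tau>"
      using that unfolding ok_def leaf_step_def by metis
    then show ?thesis using \<sigma> tree unfolding computable_binary_tree_def by blast
  qed
  ultimately have "\<not> (\<forall>n. \<exists>\<sigma>\<in>{\<sigma> \<in> T. \<not> ok \<sigma>}. n \<le> length \<sigma>)"
    using koenig[of "{\<sigma> \<in> T. \<not> ok \<sigma>}"] tree unfolding computable_binary_tree_def by blast
  then obtain n where n: "\<And>\<sigma>. \<sigma> \<in> T \<Longrightarrow> n \<le> length \<sigma> \<Longrightarrow> ok \<sigma>" by blast
  obtain \<rho> where "\<rho> \<in> leaves T" "n \<le> length \<rho>" using assms by blast
  with n[of \<rho>] show ?thesis unfolding ok_def leaves_def by blast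
qed

text \<open>\<open>iter_use\<close> tells how many values the present leaves need, then
  \<open>total_leaf_exists\<close> gives a leaf that supplies them. The tail
  \<open>\<lambda>_. 0\<close> is nowhere defined, so nothing depends on what follows the new
  leaf.\<close>

lemma extension_exists:
  assumes "\<And>n. \<exists>\<rho>\<in>leaves T. n \<le> length \<rho>" and \<rho>s: "set \<rho>s \<subseteq> leaves T"
  shows "\<exists>\<rho>\<in>leaves T. \<exists>s. \<forall>i<l. iter s (\<rho> # \<rho>s) (\<lambda>_. 0) i \<noteq> 0"
proof -
  obtain N where N: "\<forall>f\<in>P. \<exists>b. \<forall>s\<ge>b. \<forall>t. approx t f \<and> (\<forall>i<N. t i \<noteq> 0) \<longrightarrow> (\<forall>i<l. iter s \<rho>s t i \<noteq> 0)"
    using iter_use[OF \<rho>s] by blast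
  obtain \<rho> b where \<rho>: "\<rho> \<in> leaves T" and b: "\<And>s t i. b \<le> s \<Longrightarrow> i < N \<Longrightarrow> leaf_step g e s \<rho> t i \<noteq> 0"
    using total_leaf_exists[OF assms(1), of N] by blast
  \<comment> \<open>Any member of \<open>P\<close> will do: it certifies that the values supplied
    are those of a function in \<open>P\<close>, as \<open>iter_use\<close> requires.\<close>
  obtain f where f: "f \<in> P" using P_nonempty by blast
  obtain c where c: "\<And>s t. c \<le> s \<Longrightarrow> approx t (\<Phi> (\<rho> \<frown> f)) \<Longrightarrow> (\<forall>i<N. t i \<noteq> 0) \<Longrightarrow>
      (\<forall>i<l. iter s \<rho>s t i \<noteq> 0)"
    using N \<Phi>_P[OF leaf_conc[OF \<rho> f]] by blast
  have "approx (leaf_step g e (max b c) \<rho> (\<lambda>_. 0)) (\<Phi> (\<rho> \<frown> f))"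
    by (rule approx_leaf_step[OF \<rho> f]) (simp add: approx_def)
  then have "\<forall>i<l. iter (max b c) (\<rho> # \<rho>s) (\<lambda>_. 0) i \<noteq> 0"
    using c[of "max b c"] b[of "max b c"] by simp
  with \<rho> show ?thesis by blast
qed

text \<open>Below \<open>n\<close> the limit agrees with \<open>nest (\<rho>s n) f0\<close>, a
  member of \<open>P\<close>, for an arbitrary \<open>f0\<close> in \<open>P\<close>; closedness
  does the rest.\<close>

lemma limit_in_P:
  assumes \<rho>s0: "\<rho>s 0 = []" and \<rho>s_Suc: "\<And>n. \<exists>\<rho>\<in>leaves T. \<rho>s (Suc n) = \<rho> # \<rho>s n"
    and f: "\<And>n. iter (s n) (\<rho>s (Suc n)) (\<lambda>_. 0) n = Suc (f n)"
  shows "f \<in> P"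
proof (rule pi01_closed[OF P_pi01])
  fix n
  have leaves: "set (\<rho>s n) \<subseteq> leaves T" for n
  proof (induction n)
    case (Suc n)
    then show ?case using \<rho>s_Suc[of n] by auto
  qed (simp add: \<rho>s0)
  have append: "\<exists>\<sigma>s. \<rho>s (k + i) = \<sigma>s @ \<rho>s i" for i k
  proof (induction k)
    case (Suc k)
    then show ?case using \<rho>s_Suc[of "k + i"] by (metis add_Suc append_Cons)
  qed simp
  obtain f0 where f0: "f0 \<in> P" using P_nonempty by blast
  have "nest (\<rho>s n) f0 i = f i" if "i < n" for i
  proof -
    have "n - Suc i + Suc i = n" using that by simp
    then obtain \<sigma>s where \<sigma>s: "\<rho>s n = \<sigma>s @ \<rho>s (Suc i)"
      using append[of "n - Suc i" "Suc i"] by metis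
    \<comment> \<open>The leaves found later act first and merely replace the innermost argument by
      another member of \<open>P\<close>; the value at \<open>i\<close> is settled by
      \<open>\<rho>s (Suc i)\<close> alone.\<close>
    have "nest \<sigma>s f0 \<in> P" using leaves[of n] by (intro nest_P f0) (simp add: \<sigma>s)
    from approx_iter[OF leaves[of "Suc i"] this, of "\<lambda>_. 0" "s i"]
    show ?thesis using f[of i] by (simp add: approx_def \<sigma>s)
  qed
  then show "\<exists>f'\<in>P. \<forall>i<n. f' i = f i" using nest_P[OF leaves f0] by blast
qed

end

section \<open>The reductions\<close>

lemma medvedev_leI:
  assumes "computes R 1 (\<lambda>g xs. G g (xs ! 0))" "\<And>g. g \<in> R \<Longrightarrow> G g \<in> A"
  shows "A \<le>\<^sub>M R"
proof -
  obtain e where e: "\<And>g xs. g \<in> R \<Longrightarrow> length xs = 1 \<Longrightarrow> eval g e xs (G g (xs ! 0))"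
    using assms(1) unfolding computes_def by blast
  obtain \<Gamma> where \<Gamma>: "partial_computable \<Gamma>"
    and \<Gamma>_iff: "\<And>g f. \<Gamma> g = Some f \<longleftrightarrow> (\<forall>n. eval g e [n] (f n))"
    using prog_partial_computable[of e] by blast
  have "eval g e [n] (G g n)" if "g \<in> R" for g n
    using e[OF that, of "[n]"] by simp
  then have "\<Gamma> g = Some (G g)" if "g \<in> R" for g
    using that by (simp add: \<Gamma>_iff)
  with \<Gamma> assms(2) show ?thesis
    unfolding medvedev_le_def by (intro exI[of _ \<Gamma>]) (auto simp: dom_def)
qed

lemma decides_tree:
  assumes "computable_binary_tree T" "computes R k A"
  shows "decides R k (\<lambda>g xs. list_decode (A g xs) \<in> T)"
proof -
  obtain e where e: "\<And>g n. eval g e [n] (if n \<in> list_encode ` T then 1 else 0)"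
    using assms(1) unfolding computable_binary_tree_def computable_set_def by blast
  have "eval g e xs (if xs ! 0 \<in> list_encode ` T then 1 else 0)" if xs: "length xs = 1" for g xs
  proof -
    obtain n where "xs = [n]" using xs by (auto simp: length_Suc_conv)
    then show ?thesis using e[of g n] by simp
  qed
  then have "computes R 1 (\<lambda>g xs. if xs ! 0 \<in> list_encode ` T then 1 else 0)"
    unfolding computes_def by blast
  moreover have "n \<in> list_encode ` T \<longleftrightarrow> list_decode n \<in> T" for n
    by (metis image_iff list_decode_inverse list_encode_inverse)
  ultimately show ?thesis
    unfolding decides_def using computes_call1[OF _ assms(2), of "\<lambda>g n. if list_decode n \<in> T then 1 else 0"]
    by simp
qed

text \<open>As the tree is binary and closed under prefixes, it suffices to test the two children,
  which makes being a leaf decidable.\<close>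

lemma leaves_iff:
  assumes "computable_binary_tree T"
  shows "\<sigma> \<in> leaves T \<longleftrightarrow> \<sigma> \<in> T \<and> \<sigma> @ [0] \<notin> T \<and> \<sigma> @ [1] \<notin> T"
proof -
  have "\<sigma> @ [0] \<in> T \<or> \<sigma> @ [1] \<in> T" if \<tau>: "\<tau> \<in> T" "strict_prefix \<sigma> \<tau>" for \<tau>
  proof -
    obtain x \<upsilon> where x: "\<tau> = \<sigma> @ x # \<upsilon>" using \<tau>(2) by (rule strict_prefixE')
    have "\<sigma> @ [x] \<in> T" "x \<in> {0, 1}"
      using \<tau>(1) assms unfolding computable_binary_tree_def by (auto simp: x)
    then show ?thesis by auto
  qed
  moreover have "strict_prefix \<sigma> (\<sigma> @ [x])" for x by (simp add: strict_prefix_def)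
  ultimately show ?thesis unfolding leaves_def by blast
qed

section \<open>The reduction when the leaf lengths are bounded\<close>

text \<open>From length \<open>m\<close> on no string of the tree is a leaf, so taking the child 0
  if it is in \<open>T\<close> and 1 otherwise never gets stuck. The first \<open>m\<close> values
  are finite data built into the program.\<close>

lemma computable_path:
  assumes tree: "computable_binary_tree T" and f: "f \<in> paths T"
    and m: "\<And>\<rho>. \<rho> \<in> leaves T \<Longrightarrow> length \<rho> < m"
  shows "\<exists>q\<in>paths T. \<forall>R. computes R 1 (\<lambda>g xs. q (xs ! 0))"
proof -
  \<comment> \<open>\<open>c\<close> codes the values chosen before position \<open>k\<close>.
    Passing through \<open>list_encode\<close> and \<open>list_decode\<close> gives the shapes of
    \<open>computes_look\<close> and \<open>decides_tree\<close>.\<close>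
  define d where "d k c = (if k < m then look (list_decode (list_encode (map f [0..<m]))) k - 1
    else if list_decode (list_encode (list_decode c @ [0])) \<in> T then 0 else 1)" for k c
  define c where "c = rec_nat 0 (\<lambda>k c. list_encode (list_decode c @ [d k c]))"
  define q where "q k = d k (c k)" for k
  have q: "map q [0..<n] = list_decode (c n)" for n
    by (rule map_upt_eq) (simp_all add: q_def c_def)
  have "map q [0..<n] \<in> T" for n
  proof (induction n)
    case 0
    then show ?case using f by (auto simp: paths_def dest: spec[of _ 0])
  next
    case (Suc n)
    show ?case
    proof (cases "n < m")
      case True
      then have "map q [0..<Suc n] = map f [0..<Suc n]"
        by (auto simp: q_def d_def look_def)
      moreover have "map f [0..<Suc n] \<in> T" using f unfolding paths_def by blast
      ultimately show ?thesis by (simp only:)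
    next
      case False
      then have "map q [0..<n] \<notin> leaves T" using m[of "map q [0..<n]"] by auto
      then have "map q [0..<n] @ [0] \<in> T \<or> map q [0..<n] @ [1] \<in> T"
        using Suc leaves_iff[OF tree] by blast
      moreover have "q n = (if map q [0..<n] @ [0] \<in> T then 0 else 1)"
        unfolding q using False by (simp add: q_def d_def)
      ultimately show ?thesis by auto
    qed
  qed
  then have "q \<in> paths T" by (simp add: paths_def)
  moreover have "computes R 1 (\<lambda>g xs. q (xs ! 0))" for R
  proof -
    have d: "computes R 2 (\<lambda>g xs. d (xs ! 0) (xs ! 1))"
      unfolding d_def
      by (intro computes_intros computes_look decides_tree[OF tree] computes_snoc; simp)
    have "computes R 1 (\<lambda>g xs. c (xs ! 0))"
      unfolding c_def by (intro computes_rec computes_snoc computes_call2[OF d] computes_intros; simp)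
    then show ?thesis
      unfolding q_def by (intro computes_call2[OF d] computes_nth) simp
  qed
  ultimately show ?thesis by blast
qed

text \<open>The oracle \<open>q \<oplus> g\<close> is replaced by \<open>g\<close> through a search
  for a stage that answers; soundness and determinism identify the answer with
  \<open>\<Phi> g n\<close>.\<close>

lemma reduction_via_computable_point:
  assumes q: "\<And>R. computes R 1 (\<lambda>g xs. q (xs ! 0))"
    and \<Phi>: "\<And>g. g \<in> R \<Longrightarrow> \<Phi> g \<in> P" "\<And>g n. g \<in> R \<Longrightarrow> eval (q \<oplus> g) e [n] (\<Phi> g n)"
  shows "P \<le>\<^sub>M R"
proof (rule medvedev_leI)
  \<comment> \<open>The oracle is total, hence a successor everywhere; a constant family fits
    \<open>computes_stage\<close>.\<close>
  define h where "h = (\<lambda>g (c :: nat) x. Suc ((q \<oplus> g) x))"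
  have "computes R 2 (\<lambda>g xs. h g (xs ! 0) (xs ! 1))"
    unfolding h_def join_def
    by (intro computes_Suc computes_if decides_even computes_call1[OF q] computes_div2 computes_oracle computes_nth) auto
  from computes_stage[OF this, of 1 e]
  have "computes R 3 (\<lambda>g xs. stage (h g (xs ! 1)) (xs ! 0) e [xs ! 2])"
    by (simp add: numeral_eq_Suc) (erule computes_cong, auto simp: length_Suc_conv)
  from computes_call3[of R "\<lambda>g s c n. stage (h g c) s e [n]", OF this _ computes_const[of R _ 0]]
  have stage: "computes R k (\<lambda>g xs. stage (h g 0) (A g xs) e [B g xs])"
    if "computes R k A" "computes R k B" for k A B using that by simp
  have ex: "\<exists>s. stage (h g 0) s e [n] = Suc (\<Phi> g n)" if g: "g \<in> R" for g n
  proof -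
    obtain b where "\<forall>s\<ge>b. \<forall>h. (\<forall>x<b. h x = Suc ((q \<oplus> g) x)) \<longrightarrow> stage h s e [n] = Suc (\<Phi> g n)"
      using stage_complete[OF \<Phi>(2)[OF g, of n]] by blast
    then have "stage (h g 0) b e [n] = Suc (\<Phi> g n)" by (simp add: h_def)
    then show ?thesis ..
  qed
  have least: "computes R 1 (\<lambda>g xs. LEAST s. \<not> stage (h g 0) s e [xs ! 0] = 0)"
  proof (rule computes_Least)
    show "\<exists>s. \<not> stage (h g 0) s e [xs ! 0] = 0" if "g \<in> R" for g and xs :: "nat list"
      using ex[OF that, of "xs ! 0"] by (metis nat.distinct(1))
  qed (intro decides_not decides_eq stage computes_intros; simp)
  show "computes R 1 (\<lambda>g xs. stage (h g 0) (LEAST s. \<not> stage (h g 0) s e [xs ! 0] = 0) e [xs ! 0] - 1)"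
    by (intro computes_diff stage least computes_nth computes_const) simp
  show "(\<lambda>n. stage (h g 0) (LEAST s. \<not> stage (h g 0) s e [n] = 0) e [n] - 1) \<in> P" if g: "g \<in> R" for g
  proof -
    have "stage (h g 0) (LEAST s. \<not> stage (h g 0) s e [n] = 0) e [n] - 1 = \<Phi> g n" for n
    proof -
      let ?v = "stage (h g 0) (LEAST s. \<not> stage (h g 0) s e [n] = 0) e [n]"
      have "?v \<noteq> 0"
        by (rule LeastI_ex) (use ex[OF g, of n] in \<open>metis nat.distinct(1)\<close>)
      then have "?v = Suc (?v - 1)" by simp
      then have "eval (q \<oplus> g) e [n] (?v - 1)"
        by (rule stage_sound[rotated]) (simp add: h_def)
      then show ?thesis using \<Phi>(2)[OF g] by (rule eval_deterministic)
    qed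
    then show ?thesis using \<Phi>(1)[OF g] by (simp add: fun_eq_iff)
  qed
qed

section \<open>The search for leaves when their lengths are unbounded\<close>

locale leaf_search =
  fixes T :: "nat list set" and e :: prog and r :: nat
  assumes tree: "computable_binary_tree T" and r: "list_decode r \<in> leaves T"
begin

text \<open>Past the end the value is 0, which means undefined when \<open>c\<close> codes a partial
  function.\<close>

definition entry :: "nat \<Rightarrow> nat \<Rightarrow> nat" where
  "entry c i = look (list_decode c) i - 1"

text \<open>Replacing codes of other strings by the fixed leaf \<open>r\<close> makes the search below succeed on
  arbitrary lists, not only on those which occur.\<close>

definition leaf_of :: "nat \<Rightarrow> nat" where
  "leaf_of c = (if list_decode c \<in> leaves T then c else r)"

text \<open>The pair coded by \<open>c\<close> consists of a leaf and of a list of values of a partial function.\<close>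

definition code_oracle :: "(nat \<Rightarrow> nat) \<Rightarrow> nat \<Rightarrow> nat \<Rightarrow> nat" where
  "code_oracle g c = partial_oracle g (list_decode (fst (prod_decode c))) (entry (snd (prod_decode c)))"

text \<open>\<open>leaf_step\<close> on codes; the empty list \<open>list_decode 0\<close> gives the
  shape of \<open>computes_map_upt\<close>.\<close>

definition code_step :: "(nat \<Rightarrow> nat) \<Rightarrow> nat \<Rightarrow> nat \<Rightarrow> nat \<Rightarrow> nat" where
  "code_step g s c t = list_encode
    (map (\<lambda>i. stage (code_oracle g (prod_encode (c, t))) s e [i]) [0..<s] @ list_decode 0)"

text \<open>The recursion starts at code 0, the nowhere defined function, and the head of
  \<open>L\<close> acts first, being the innermost leaf.\<close>

definition run :: "(nat \<Rightarrow> nat) \<Rightarrow> nat \<Rightarrow> nat \<Rightarrow> nat \<Rightarrow> nat" where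
  "run g s L m = rec_nat 0 (\<lambda>i t. code_step g s (leaf_of (entry L i)) t) m"

text \<open>\<open>w\<close> codes a candidate leaf together with a cut-off, so that one unbounded
  search covers both; the candidate becomes the head of \<open>L\<close>.\<close>

definition run_ext :: "(nat \<Rightarrow> nat) \<Rightarrow> nat \<Rightarrow> nat \<Rightarrow> nat \<Rightarrow> nat" where
  "run_ext g w L m = run g (snd (prod_decode w)) (Suc (prod_encode (fst (prod_decode w), L))) (Suc m)"

definition good :: "(nat \<Rightarrow> nat) \<Rightarrow> nat \<Rightarrow> nat \<Rightarrow> nat \<Rightarrow> bool" where
  "good g w m L \<longleftrightarrow> (\<forall>i<Suc m. \<not> entry (run_ext g w L m) i = 0)"

definition search :: "(nat \<Rightarrow> nat) \<Rightarrow> nat \<Rightarrow> nat \<Rightarrow> nat" where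
  "search g m L = (LEAST w. good g w m L)"

text \<open>The list of leaves found so far, the latest (innermost) one first.\<close>

definition chosen :: "(nat \<Rightarrow> nat) \<Rightarrow> nat \<Rightarrow> nat" where
  "chosen g n = rec_nat 0 (\<lambda>m L. Suc (prod_encode (fst (prod_decode (search g m L)), L))) n"

definition limit :: "(nat \<Rightarrow> nat) \<Rightarrow> nat \<Rightarrow> nat" where
  "limit g n = entry (run_ext g (search g n (chosen g n)) (chosen g n) n) n - 1"

lemma computes_entry:
  "computes R k A \<Longrightarrow> computes R k B \<Longrightarrow> computes R k (\<lambda>g xs. entry (A g xs) (B g xs))"
  unfolding entry_def by (intro computes_diff computes_look computes_const)

lemma computes_leaf_of:
  assumes "computes R k A" shows "computes R k (\<lambda>g xs. leaf_of (A g xs))"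
proof -
  have "decides R k (\<lambda>g xs. list_decode (A g xs) \<in> T \<and>
      \<not> list_decode (list_encode (list_decode (A g xs) @ [0])) \<in> T \<and>
      \<not> list_decode (list_encode (list_decode (A g xs) @ [1])) \<in> T)"
    by (intro decides_conj decides_not decides_tree tree computes_snoc computes_const assms)
  then have "decides R k (\<lambda>g xs. list_decode (A g xs) \<in> leaves T)"
    by (simp add: leaves_iff[OF tree])
  then show ?thesis unfolding leaf_of_def by (intro computes_if assms computes_const)
qed

lemma computes_code_step:
  assumes "computes R k A" "computes R k B" "computes R k C"
  shows "computes R k (\<lambda>g xs. code_step g (A g xs) (B g xs) (C g xs))"
proof (rule computes_call3[OF _ assms])
  have "code_oracle g c x = (if even x then
      if x div 2 < length (list_decode (fst (prod_decode c)))
      then look (list_decode (fst (prod_decode c))) (x div 2)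
      else entry (snd (prod_decode c)) (x div 2 - length (list_decode (fst (prod_decode c))))
    else Suc (g (x div 2)))" for g c x
    by (simp add: code_oracle_def partial_oracle_def look_def)
  then have "computes R 2 (\<lambda>g xs. code_oracle g (xs ! 0) (xs ! 1))"
    by (simp only:) (intro computes_if decides_even decides_less computes_div2 computes_length computes_look
        computes_entry computes_prod_decode computes_Suc computes_oracle computes_diff computes_nth; simp)
  from computes_stage[OF this, of 1 e]
  have "computes R 3 (\<lambda>g xs. stage (code_oracle g (xs ! 1)) (xs ! 0) e [xs ! 2])"
    by (simp add: numeral_eq_Suc) (erule computes_cong, auto simp: length_Suc_conv)
  note stage = computes_call3[of R "\<lambda>g s c n. stage (code_oracle g c) s e [n]", OF this]
  show "computes R 3 (\<lambda>g xs. code_step g (xs ! 0) (xs ! 1) (xs ! 2))"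
    unfolding code_step_def
    by (intro computes_map_upt stage computes_prod_encode computes_intros; simp)
qed

lemma computes_run:
  assumes "computes R k A" "computes R k B" "computes R k C"
  shows "computes R k (\<lambda>g xs. run g (A g xs) (B g xs) (C g xs))"
  unfolding run_def
  by (intro computes_rec computes_code_step computes_leaf_of computes_entry computes_drop computes_nth computes_const assms) auto

lemma computes_run_ext:
  assumes "computes R k A" "computes R k B" "computes R k C"
  shows "computes R k (\<lambda>g xs. run_ext g (A g xs) (B g xs) (C g xs))"
  unfolding run_ext_def
  by (intro computes_run computes_prod_decode computes_Suc computes_prod_encode assms)

lemma decides_good: "decides R 3 (\<lambda>g xs. good g (xs ! 0) (xs ! 1) (xs ! 2))"
  unfolding good_def
  by (intro decides_all decides_not decides_eq computes_entry computes_run_ext computes_intros; simp)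

lemma computes_limit:
  assumes "\<And>g m L. g \<in> R \<Longrightarrow> \<exists>w. good g w m L"
  shows "computes R 1 (\<lambda>g xs. limit g (xs ! 0))"
proof -
  have "decides R (Suc 2) (\<lambda>g ys. good g (ys ! 0) (tl ys ! 0) (tl ys ! 1))"
    using decides_good[of R] by (simp add: numeral_eq_Suc) (erule decides_cong, auto simp: length_Suc_conv)
  then have "computes R 2 (\<lambda>g xs. search g (xs ! 0) (xs ! 1))"
    unfolding search_def by (rule computes_Least) (rule assms)
  note search = computes_call2[of R search, OF this]
  have "computes R 1 (\<lambda>g xs. chosen g (xs ! 0))"
    unfolding chosen_def
    by (intro computes_rec search computes_Suc computes_prod_encode computes_prod_decode computes_nth computes_const; simp)
  then show ?thesis
    unfolding limit_def
    by (intro computes_diff computes_entry computes_run_ext search computes_nth computes_const) auto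
qed

definition leaf_list :: "nat \<Rightarrow> nat \<Rightarrow> nat list list" where
  "leaf_list L m = map (\<lambda>i. list_decode (leaf_of (entry L i))) [0..<m]"

lemma leaf_of_in_leaves: "list_decode (leaf_of c) \<in> leaves T"
  using r by (simp add: leaf_of_def)

lemma leaf_list_subset: "set (leaf_list L m) \<subseteq> leaves T"
  by (auto simp: leaf_list_def leaf_of_in_leaves)

lemma leaf_list_Suc: "leaf_list (Suc (prod_encode (c, L))) (Suc m) = list_decode (leaf_of c) # leaf_list L m"
  unfolding leaf_list_def by (subst upt_rec) (simp add: entry_def look_def map_Suc_upt[symmetric] comp_def del: upt_Suc)

lemma entry_code_step: "entry (code_step g s c t) = leaf_step g e s (list_decode c) (entry t)"
  by (rule ext) (simp add: entry_def code_step_def look_def leaf_step_def code_oracle_def)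

lemma entry_run: "entry (run g s L m) = fold (leaf_step g e s) (leaf_list L m) (\<lambda>_. 0)"
proof (induction m)
  case 0
  show ?case by (rule ext) (simp add: run_def leaf_list_def entry_def look_def)
next
  case (Suc m)
  have "entry (run g s L (Suc m)) = leaf_step g e s (list_decode (leaf_of (entry L m))) (entry (run g s L m))"
    by (simp add: run_def entry_code_step)
  with Suc show ?case by (simp add: leaf_list_def)
qed

lemma entry_run_ext:
  "entry (run_ext g w L m) = fold (leaf_step g e (snd (prod_decode w)))
    (list_decode (leaf_of (fst (prod_decode w))) # leaf_list L m) (\<lambda>_. 0)"
  unfolding run_ext_def entry_run leaf_list_Suc ..

text \<open>Transfers the results of \<open>cupping\<close> to codes:
  \<open>extension_exists\<close> makes each search succeed, and \<open>limit_in_P\<close> applies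
  to the leaves found.\<close>

lemma limit_in:
  assumes cup: "cupping P T g e \<Phi>" and inf: "\<And>n. \<exists>\<rho>\<in>leaves T. n \<le> length \<rho>"
  shows "\<exists>w. good g w m L" "limit g \<in> P"
proof -
  show ex: "\<exists>w. good g w m L" for m L
  proof -
    obtain \<rho> s where "\<rho> \<in> leaves T" "\<forall>i<Suc m. fold (leaf_step g e s) (\<rho> # leaf_list L m) (\<lambda>_. 0) i \<noteq> 0"
      using cupping.extension_exists[OF cup inf leaf_list_subset] by blast
    then have "good g (prod_encode (list_encode \<rho>, s)) m L"
      unfolding good_def entry_run_ext by (simp add: leaf_of_def)
    then show ?thesis ..
  qed
  show "limit g \<in> P"
  proof (rule cupping.limit_in_P[OF cup])
    let ?w = "\<lambda>n. search g n (chosen g n)"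
    have chosen: "leaf_list (chosen g (Suc n)) (Suc n) = list_decode (leaf_of (fst (prod_decode (?w n)))) # leaf_list (chosen g n) n" for n
      using leaf_list_Suc by (simp add: chosen_def)
    show "leaf_list (chosen g 0) 0 = []" by (simp add: leaf_list_def)
    show "\<exists>\<rho>\<in>leaves T. leaf_list (chosen g (Suc n)) (Suc n) = \<rho> # leaf_list (chosen g n) n" for n
      using chosen leaf_of_in_leaves by blast
    show "fold (leaf_step g e (snd (prod_decode (?w n)))) (leaf_list (chosen g (Suc n)) (Suc n)) (\<lambda>_. 0) n = Suc (limit g n)" for n
    proof -
      have "good g (?w n) n (chosen g n)" unfolding search_def by (rule LeastI_ex[OF ex])
      then have "entry (run_ext g (?w n) (chosen g n) n) n \<noteq> 0" by (simp add: good_def)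
      then show ?thesis unfolding chosen limit_def entry_run_ext by simp
    qed
  qed
qed

end

theorem theorem26:
  fixes P Q :: "(nat \<Rightarrow> nat) set" and T_Q :: "nat list set"
  assumes "pi01 P" and "P \<subseteq> cantor" and "P \<noteq> {}"
    and "pi01 Q" and "Q \<subseteq> cantor" and "Q \<noteq> {}"
    and "computable_binary_tree T_Q" and "paths T_Q = Q"
  shows "\<forall>R :: (nat \<Rightarrow> nat) set. P \<le>\<^sub>M concatenation T_Q P \<otimes> R \<longrightarrow> P \<le>\<^sub>M R"
proof (intro allI impI)
  fix R :: "(nat \<Rightarrow> nat) set" assume "P \<le>\<^sub>M concatenation T_Q P \<otimes> R"
  then obtain \<Gamma> e where e: "\<And>g f. \<Gamma> g = Some f \<longleftrightarrow> (\<forall>n. eval g e [n] (f n))"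
    and dom: "concatenation T_Q P \<otimes> R \<subseteq> dom \<Gamma>" and \<Gamma>: "\<And>g. g \<in> concatenation T_Q P \<otimes> R \<Longrightarrow> the (\<Gamma> g) \<in> P"
    unfolding medvedev_le_def partial_computable_def by blast
  define \<Phi> where "\<Phi> g f = the (\<Gamma> (f \<oplus> g))" for f g
  have prod: "f \<oplus> g \<in> concatenation T_Q P \<otimes> R" if "f \<in> concatenation T_Q P" "g \<in> R" for f g
    using that unfolding product_def by blast
  have \<Phi>_P: "\<Phi> g f \<in> P" if "f \<in> concatenation T_Q P" "g \<in> R" for f g
    unfolding \<Phi>_def by (rule \<Gamma>[OF prod[OF that]])
  have \<Phi>_eval: "eval (f \<oplus> g) e [n] (\<Phi> g f n)" if "f \<in> concatenation T_Q P" "g \<in> R" for f g n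
  proof -
    have "\<Gamma> (f \<oplus> g) = Some (\<Phi> g f)" using dom prod[OF that] by (auto simp: \<Phi>_def)
    then show ?thesis by (simp add: e)
  qed
  show "P \<le>\<^sub>M R"
  proof (cases "\<forall>n. \<exists>\<rho>\<in>leaves T_Q. n \<le> length \<rho>")
    case True
    \<comment> \<open>Any leaf serves as the default \<open>r\<close> of
      \<open>leaf_search\<close>.\<close>
    then obtain \<rho> where "\<rho> \<in> leaves T_Q" by blast
    then interpret leaf_search T_Q e "list_encode \<rho>"
      by unfold_locales (simp_all add: assms)
    \<comment> \<open>The program \<open>e\<close> and the search are the same for all
      \<open>g\<close>; only correctness is checked for each \<open>g\<close> separately.\<close>
    have cup: "cupping P T_Q g e (\<Phi> g)" if "g \<in> R" for g
      by unfold_locales (simp_all add: assms that \<Phi>_P \<Phi>_eval)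
    show ?thesis
      by (rule medvedev_leI[OF computes_limit]) (use limit_in[OF cup] True in blast)+
  next
    case False
    then obtain m where m: "\<And>\<rho>. \<rho> \<in> leaves T_Q \<Longrightarrow> length \<rho> < m" by (auto simp: not_le)
    \<comment> \<open>Bounded leaf lengths alone do not give a path, as the tree might be finite;
      \<open>Q \<noteq> {}\<close> does.\<close>
    obtain f where "f \<in> paths T_Q" using assms by blast
    then obtain q where q: "q \<in> paths T_Q" "\<And>R. computes R 1 (\<lambda>g xs. q (xs ! 0))"
      using computable_path[OF assms(7) _ m] by blast
    have "q \<in> concatenation T_Q P" using q(1) by (simp add: concatenation_def)
    then show ?thesis
      using reduction_via_computable_point[OF q(2), of R "\<lambda>g. \<Phi> g q" P e] \<Phi>_P \<Phi>_eval by blast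
  qed
qed

end
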